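(* In the directed FCFS bipartite matching model, assume the stability condition $\lambda_C<\mu_{\mathcal S(C)}$ for every nonempty $C\subseteq\mathcal C$. Then for $(s_j,c_i)\in\mathcal G$ the matching rates are $$r_{s_j,c_i}=\frac{\mu_{s_j}}{\bar\mu}\sum_{k=1}^I\ \sum_{C\subseteq\mathcal C,\,|C|=k}\ \sum_{(C_1,\dots,C_k)\in\mathcal P(C)}\pi_Y(C_1,\cdot,\dots,C_k,\cdot)\; \mathbf 1\Big(\exists\, l\in\{1,\dots,k\}:\ C_l=c_i\ \text{and}\ \{C_1,\dots,C_{l-1}\}\cap\mathcal C(s_j)=\emptyset\Big),$$ and the rates of unmatched goods are $$r_{s_j,\emptyset}=\frac{\mu_{s_j}}{\bar\mu}\sum_{k=0}^I\ \sum_{C\subseteq\mathcal C,\,|C|=k}\ \sum_{(C_1,\dots,C_k)\in\mathcal P(C)}\pi_Y(C_1,\cdot,\dots,C_k,\cdot)\; \mathbf 1\big(\{C_1,\dots,C_k\}\cap\mathcal C(s_j)=\emptyset\big),$$ where $\mathcal P(C)$ is the set of orderings (permutations) of $C$ and the $k=0$ term of the last sum is $\pi_Y(\emptyset)$.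
   Context: Model. $\mathcal C=\{c_1,\dots,c_I\}$ (agent types) and $\mathcal S=\{s_1,\dots,s_J\}$ (good types) are disjoint finite sets, $\mathcal G\subseteq\mathcal S\times\mathcal C$ is a bipartite compatibility graph, $\bar\lambda,\bar\mu>0$, and $\alpha,\beta$ are probability vectors on $\mathcal C,\mathcal S$. Put $\lambda_{c_i}=\bar\lambda\alpha_{c_i}$, $\mu_{s_j}=\bar\mu\beta_{s_j}$. The sequence $(z^n)_{n\in\mathbb Z}$ is i.i.d. with $P(z^n=c_i)=\lambda_{c_i}/(\bar\lambda+\bar\mu)$, $P(z^n=s_j)=\mu_{s_j}/(\bar\lambda+\bar\mu)$. For $C\subseteq\mathcal C$: $\mathcal S(C)=\{s_j:(s_j,c)\in\mathcal G\text{ for some }c\in C\}$, $\lambda_C=\sum_{c\in C}\lambda_c$; for $S\subseteq\mathcal S$: $\mu_S=\sum_{s\in S}\mu_s$; $\mathcal C(s_j)=\{c_i:(s_j,c_i)\in\mathcal G\}$. Directed FCFS matching: each item is matched at most once, and a good $z^n=s_j$ is matched with an agent $z^m=c_i$ if and only if (i) $n>m$; (ii) $(s_j,c_i)\in\mathcal G$; (iii) for every $k<m$ with $z^k=c_{i'}$ and $(s_j,c_{i'})\in\mathcal G$ there is $l<n$ such that $z^l$ is matched with $z^k$. A good with no such match remains unmatched (lost). Under the stability condition there is almost surely a unique such matching of $(z^n)_{n\in\mathbb Z}$ in which all agents are matched. Matching rates: $r_{s_j,c_i}$ is the (almost sure) long-run fraction, among all goods in the sequence, of goods that are of type $s_j$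 and are matched to an agent of type $c_i$; $r_{s_j,\emptyset}$ is the long-run fraction, among all goods, of goods that are of type $s_j$ and remain unmatched. Thus $\sum_{s_j}\big(r_{s_j,\emptyset}+\sum_{c_i}r_{s_j,c_i}\big)=1$. $X(N)$ is the list, in order of position, of the types of agents in positions $\le N$ not matched to goods in positions $\le N$. $\pi_Y(C_1,\cdot,\dots,C_k,\cdot)$ is the stationary probability that the distinct agent types appearing in $X(N)$, in order of first appearance, are exactly $C_1,\dots,C_k$, and $\pi_Y(\emptyset)=P(X(N)=\emptyset)$. Explicitly, $\pi_Y(C_1,\cdot,\dots,C_k,\cdot)=B\prod_{\ell=1}^k\frac{\lambda_{C_\ell}}{\mu_{\mathcal S(\{C_1,\dots,C_\ell\})}-\lambda_{\{C_1,\dots,C_\ell\}}}$ and $\pi_Y(\emptyset)=B$, where $B$ makes these probabilities sum to $1$ over all orderings of all subsets of $\mathcal C$. *)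

theory Defs
  imports "HOL-Probability.Probability" "HOL-Combinatorics.Multiset_Permutations"
begin

text \<open>
  Agent types and good types are the elements of two finite types \<open>'c\<close> and \<open>'s\<close>; an item of the
  sequence lives in their disjoint sum. The compatibility graph is a relation \<open>G :: ('s \<times> 'c) set\<close>.
\<close>

type_synonym ('c, 's) item = "'c + 's"

abbreviation Agent :: "'c \<Rightarrow> ('c, 's) item" where "Agent \<equiv> Inl"
abbreviation Good :: "'s \<Rightarrow> ('c, 's) item" where "Good \<equiv> Inr"

definition goods_of :: "('s \<times> 'c) set \<Rightarrow> 'c set \<Rightarrow> 's set" where
  "goods_of G C = {s. \<exists>c\<in>C. (s, c) \<in> G}"

definition agents_of :: "('s \<times> 'c) set \<Rightarrow> 's \<Rightarrow> 'c set" where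
  "agents_of G s = {c. (s, c) \<in> G}"

definition stability_condition :: "('s::finite \<times> 'c::finite) set \<Rightarrow> ('c \<Rightarrow> real) \<Rightarrow> ('s \<Rightarrow> real) \<Rightarrow> bool" where
  "stability_condition G lam mu \<longleftrightarrow> (\<forall>C. C \<noteq> {} \<longrightarrow> sum lam C < sum mu (goods_of G C))"

text \<open>
  \<open>(n, m) \<in> A\<close> means that the good in position \<open>n\<close> is matched with the agent in position \<open>m\<close>.
  The clause \<open>\<forall>l<n. (l, m) \<notin> A\<close> says that the agent is still available when the good arrives.
  It is needed in the equivalence: an agent that was taken before time \<open>n\<close> may
  satisfy all the other clauses, although it cannot be matched a second time.
\<close>

definition directed_fcfs_matching ::
  "('s \<times> 'c) set \<Rightarrow> (int \<Rightarrow> ('c, 's) item) \<Rightarrow> (int \<times> int) set \<Rightarrow> bool" where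
  "directed_fcfs_matching G w A \<longleftrightarrow>
     (\<forall>n m. (n, m) \<in> A \<longrightarrow> (\<exists>s c. w n = Good s \<and> w m = Agent c)) \<and>
     (\<forall>n m m'. (n, m) \<in> A \<and> (n, m') \<in> A \<longrightarrow> m = m') \<and>
     (\<forall>n n' m. (n, m) \<in> A \<and> (n', m) \<in> A \<longrightarrow> n = n') \<and>
     (\<forall>n m s c. w n = Good s \<and> w m = Agent c \<longrightarrow>
        ((n, m) \<in> A \<longleftrightarrow>
           n > m \<and> (s, c) \<in> G \<and>
           (\<forall>k<m. \<forall>c'. w k = Agent c' \<and> (s, c') \<in> G \<longrightarrow> (\<exists>l<n. (l, k) \<in> A)) \<and>
           (\<forall>l<n. (l, m) \<notin> A)))"

definition all_agents_matched :: "(int \<Rightarrow> ('c, 's) item) \<Rightarrow> (int \<times> int) set \<Rightarrow> bool" where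
  "all_agents_matched w A \<longleftrightarrow> (\<forall>m c. w m = Agent c \<longrightarrow> (\<exists>n. (n, m) \<in> A))"

definition good_positions :: "(int \<Rightarrow> ('c, 's) item) \<Rightarrow> nat \<Rightarrow> int set" where
  "good_positions w N = {n \<in> {1..int N}. \<exists>s. w n = Good s}"

definition matched_fraction ::
  "(int \<Rightarrow> ('c, 's) item) \<Rightarrow> (int \<times> int) set \<Rightarrow> 's \<Rightarrow> 'c \<Rightarrow> nat \<Rightarrow> real" where
  "matched_fraction w A s c N =
     real (card {n \<in> good_positions w N. w n = Good s \<and> (\<exists>m. (n, m) \<in> A \<and> w m = Agent c)})
     / real (card (good_positions w N))"

definition unmatched_fraction ::
  "(int \<Rightarrow> ('c, 's) item) \<Rightarrow> (int \<times> int) set \<Rightarrow> 's \<Rightarrow> nat \<Rightarrow> real" where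
  "unmatched_fraction w A s N =
     real (card {n \<in> good_positions w N. w n = Good s \<and> (\<nexists>m. (n, m) \<in> A)})
     / real (card (good_positions w N))"

text \<open>
  An ordering \<open>(C\<^sub>1, \<dots>, C\<^sub>k)\<close> is a duplicate-free list \<open>Cs\<close>, indexed from 0, so that
  \<open>{C\<^sub>1, \<dots>, C\<^sub>\<ell>}\<close> with \<open>\<ell> = l + 1\<close> is \<open>set (take (Suc l) Cs)\<close>.
\<close>

definition ordering_weight ::
  "('s::finite \<times> 'c::finite) set \<Rightarrow> ('c \<Rightarrow> real) \<Rightarrow> ('s \<Rightarrow> real) \<Rightarrow> 'c list \<Rightarrow> real" where
  "ordering_weight G lam mu Cs =
     (\<Prod>l<length Cs. lam (Cs ! l) /
        (sum mu (goods_of G (set (take (Suc l) Cs))) - sum lam (set (take (Suc l) Cs))))"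

definition norm_const ::
  "('s::finite \<times> 'c::finite) set \<Rightarrow> ('c \<Rightarrow> real) \<Rightarrow> ('s \<Rightarrow> real) \<Rightarrow> real" where
  "norm_const G lam mu =
     1 / (\<Sum>C\<in>(UNIV :: 'c set set). \<Sum>Cs\<in>permutations_of_set C. ordering_weight G lam mu Cs)"

definition pi_Y ::
  "('s::finite \<times> 'c::finite) set \<Rightarrow> ('c \<Rightarrow> real) \<Rightarrow> ('s \<Rightarrow> real) \<Rightarrow> 'c list \<Rightarrow> real" where
  "pi_Y G lam mu Cs = norm_const G lam mu * ordering_weight G lam mu Cs"

end

theory Submission
  imports Defs
begin

text \<open>
  Since every agent is matched, only finitely many agents are waiting at time 0, and from then on
  the list of waiting types is a Markov chain driven by the i.i.d. items. It suffices to show that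
  from every initial list the chain almost surely visits each set of lists with the frequency given
  by the product-form distribution \<open>\<pi>\<close>: the next item is independent of the current list, and
  which agent a good takes depends only on the order of first appearance of the types.

  The ergodic theorem uses a Lyapunov function \<open>V\<close>, the expected time to empty the list.
  Invariance of \<open>\<pi>\<close> alone gives Kac's bound on \<open>V\<close> after one step from the
  empty list. Inserting one agent into the list changes the later lists by at most one
  agent, so \<open>V\<close> has bounded increments, and the law of large numbers for bounded martingale
  differences yields frequency at least \<open>\<pi>({[]})\<close> for the empty list. Applying the same law to the
  expected time spent in a set \<open>E\<close> before emptying (truncated at \<open>n\<close> steps, then \<open>n \<longrightarrow> \<infinity>\<close>) gives
  frequency at least \<open>\<pi>(E)\<close>, and complements give equality.
\<close>

section \<open>Law of large numbers along a chain driven by i.i.d. inputs\<close>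

text \<open>The matching is quantified inside the almost-sure statement, so the list at time 0 may
  depend on the whole sample path in an uncontrolled way. This is why no stationary version of the
  queue is used: convergence is proved for each deterministic initial list, and as there are only
  countably many lists, one null set serves them all.

  Rates \<open>lam c\<close> may vanish. Lists containing such types have probability 0 under \<pi>,
  but the claim for every initial list includes them. Neither irreducibility nor statements that
  hold \<pi>-almost surely would cover them, so the bound on emptying times has to hold from every
  list.

  The list (c_1, ..., c_n) gets a weight proportional to the product of lam(c_i) / mu(S({c_1, ...,
  c_i})). Once the type set C has been seen, each further agent of a type c in C contributes the
  factor lam(c) / mu(S(C)), so repetitions sum to a geometric series of ratio lam(C) / mu(S(C)).
  This turns the denominator mu(S(C)) into mu(S(C)) - lam(C), as in the formula for
  \<open>pi_Y\<close>; stability makes the series converge.\<close>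

lemma prod_list_map_eq_prod_nth: "prod_list (map f xs) = (\<Prod>i<length xs. f (xs ! i))"
  by (induction xs) (simp_all add: prod.lessThan_Suc_shift del: prod.lessThan_Suc)

text \<open>The expectation over n i.i.d. letters is a finite sum, so the martingale argument
  becomes an induction that splits off the first letter, with an arbitrary starting state.
  Filtrations and conditional expectations do not appear.\<close>

definition word_mean :: "'z::finite pmf \<Rightarrow> nat \<Rightarrow> ('z list \<Rightarrow> real) \<Rightarrow> real" where
  "word_mean q n f = (\<Sum>xs | length xs = n. prod_list (map (pmf q) xs) * f xs)"

lemma word_mean_0 [simp]: "word_mean q 0 f = f []"
  by (simp add: word_mean_def)

lemma word_mean_Suc:
  fixes q :: "'z::finite pmf"
  shows "word_mean q (Suc n) f = (\<Sum>z\<in>UNIV. pmf q z * word_mean q n (\<lambda>xs. f (z # xs)))"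
proof -
  have "{xs :: 'z list. length xs = Suc n} = (\<lambda>(z, xs). z # xs) ` (UNIV \<times> {xs. length xs = n})"
    by (auto simp: length_Suc_conv)
  moreover have "inj_on (\<lambda>(z, xs). z # xs) (UNIV \<times> {xs :: 'z list. length xs = n})"
    by (auto simp: inj_on_def)
  ultimately have "word_mean q (Suc n) f =
      (\<Sum>(z, xs)\<in>UNIV \<times> {xs. length xs = n}. pmf q z * (prod_list (map (pmf q) xs) * f (z # xs)))"
    unfolding word_mean_def by (simp add: sum.reindex case_prod_unfold mult.assoc)
  then show ?thesis
    by (simp add: word_mean_def sum.cartesian_product sum_distrib_left)
qed

lemma word_mean_const [simp]: "word_mean q n (\<lambda>_. c) = c"
proof (induction n)
  case (Suc n)
  have "(\<Sum>z\<in>UNIV. pmf q z) = 1" by (simp add: sum_pmf_eq_1)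
  then show ?case using Suc by (simp add: word_mean_Suc flip: sum_distrib_right)
qed simp

lemma word_mean_add: "word_mean q n (\<lambda>xs. f xs + g xs) = word_mean q n f + word_mean q n g"
  by (simp add: word_mean_def sum.distrib distrib_left)

lemma word_mean_cmult: "word_mean q n (\<lambda>xs. c * f xs) = c * word_mean q n f"
  by (simp add: word_mean_def sum_distrib_left mult.left_commute)

primrec path_sum :: "('x \<Rightarrow> 'z \<Rightarrow> 'x) \<Rightarrow> ('x \<Rightarrow> 'z \<Rightarrow> real) \<Rightarrow> 'x \<Rightarrow> 'z list \<Rightarrow> real" where
  "path_sum step \<phi> x [] = 0"
| "path_sum step \<phi> x (z # zs) = \<phi> x z + path_sum step \<phi> (step x z) zs"

definition state :: "('x \<Rightarrow> 'z \<Rightarrow> 'x) \<Rightarrow> 'x \<Rightarrow> (nat \<Rightarrow> 'z) \<Rightarrow> nat \<Rightarrow> 'x" where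
  "state step x \<zeta> n = foldl step x (map \<zeta> [0..<n])"

lemma state_0 [simp]: "state step x \<zeta> 0 = x"
  and state_Suc [simp]: "state step x \<zeta> (Suc n) = step (state step x \<zeta> n) (\<zeta> n)"
  by (simp_all add: state_def)

lemma path_sum_snoc:
  "path_sum step \<phi> x (zs @ [z]) = path_sum step \<phi> x zs + \<phi> (foldl step x zs) z"
  by (induction zs arbitrary: x) auto

lemma path_sum_eq_sum_state:
  "path_sum step \<phi> x (map \<zeta> [0..<n]) = (\<Sum>k<n. \<phi> (state step x \<zeta> k) (\<zeta> k))"
  by (induction n) (auto simp: path_sum_snoc state_def)

lemma word_mean_path_sum_eq_0:
  assumes "\<And>x. (\<Sum>z\<in>UNIV. pmf q z * \<phi> x z) = 0"
  shows "word_mean q n (path_sum step \<phi> x) = 0"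
proof (induction n arbitrary: x)
  case (Suc n)
  then show ?case using assms[of x]
    by (simp add: word_mean_Suc word_mean_add)
qed simp

text \<open>Orthogonality of martingale differences: given the first letter, the cross term is a
  constant times a path sum of mean 0, so only the n squares remain, each at most
  \<open>K\<^sup>2\<close>.\<close>

lemma word_mean_path_sum_square_le:
  assumes mean: "\<And>x. (\<Sum>z\<in>UNIV. pmf q z * \<phi> x z) = 0"
    and bound: "\<And>x z. \<bar>\<phi> x z\<bar> \<le> K"
  shows "word_mean q n (\<lambda>zs. (path_sum step \<phi> x zs)\<^sup>2) \<le> real n * K\<^sup>2"
proof (induction n arbitrary: x)
  case (Suc n)
  have "word_mean q n (\<lambda>zs. (\<phi> x z + path_sum step \<phi> (step x z) zs)\<^sup>2) \<le> real (Suc n) * K\<^sup>2" for z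
  proof -
    have "word_mean q n (\<lambda>zs. (\<phi> x z + path_sum step \<phi> (step x z) zs)\<^sup>2) =
        word_mean q n (\<lambda>zs. (\<phi> x z)\<^sup>2 + ((path_sum step \<phi> (step x z) zs)\<^sup>2 +
          (2 * \<phi> x z) * path_sum step \<phi> (step x z) zs))"
      by (simp add: power2_sum add.assoc)
    also have "\<dots> = (\<phi> x z)\<^sup>2 + word_mean q n (\<lambda>zs. (path_sum step \<phi> (step x z) zs)\<^sup>2)"
      unfolding word_mean_add word_mean_cmult
      by (simp add: word_mean_path_sum_eq_0[where \<phi> = \<phi>, OF mean])
    also have "\<dots> \<le> K\<^sup>2 + real n * K\<^sup>2"
      using power_mono[OF bound[of x z], of 2] Suc.IH[of "step x z"] by (intro add_mono) auto
    finally show ?thesis by (simp add: distrib_right)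
  qed
  then have "word_mean q (Suc n) (\<lambda>zs. (path_sum step \<phi> x zs)\<^sup>2) \<le>
      (\<Sum>z\<in>UNIV. pmf q z * (real (Suc n) * K\<^sup>2))"
    unfolding word_mean_Suc path_sum.simps by (intro sum_mono mult_left_mono) auto
  also have "\<dots> = real (Suc n) * K\<^sup>2"
    by (simp add: sum_pmf_eq_1 flip: sum_distrib_right)
  finally show ?case .
qed simp

text \<open>Between k^2 and the next square only O(k) bounded terms are added, which is negligible
  against k^2. Hence second moments suffice: they need to be summable only along the
  squares.\<close>

lemma averages_tendsto_0_if_square_subsequence:
  fixes d :: "nat \<Rightarrow> real"
  assumes sub: "(\<lambda>k. (\<Sum>i<k\<^sup>2. d i) / real (k\<^sup>2)) \<longlonglongrightarrow> 0"
    and bound: "\<And>i. \<bar>d i\<bar> \<le> K"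
  shows "(\<lambda>n. (\<Sum>i<n. d i) / real n) \<longlonglongrightarrow> 0"
proof -
  define k where "k n = floor_sqrt n" for n
  have k_le: "(k n)\<^sup>2 \<le> n" and k_gt: "n < (Suc (k n))\<^sup>2" for n
    by (auto simp: k_def Suc_floor_sqrt_power2_gt)
  have K0: "0 \<le> K" using bound[of 0] by linarith
  have k_lim: "filterlim k at_top at_top"
    unfolding filterlim_at_top
  proof (intro allI)
    fix m show "eventually (\<lambda>n. m \<le> k n) at_top"
      using eventually_ge_at_top[of "m\<^sup>2"]
      by eventually_elim (use k_gt in \<open>meson leI le_less_trans less_Suc_eq_le power2_less_imp_less zero_le\<close>)
  qed
  have "(\<lambda>n. \<bar>(\<Sum>i<(k n)\<^sup>2. d i) / real ((k n)\<^sup>2)\<bar> + 3 * K / real (k n)) \<longlonglongrightarrow> \<bar>0\<bar> + 0"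
    by (intro tendsto_add tendsto_rabs filterlim_compose[OF sub k_lim]
        tendsto_divide_0[OF tendsto_const] filterlim_compose[OF filterlim_real_sequentially k_lim]
        filterlim_at_top_imp_at_infinity)
  then have lim: "(\<lambda>n. \<bar>(\<Sum>i<(k n)\<^sup>2. d i) / real ((k n)\<^sup>2)\<bar> + 3 * K / real (k n)) \<longlonglongrightarrow> 0"
    by simp
  show ?thesis
  proof (rule Lim_null_comparison[OF _ lim])
    show "\<forall>\<^sub>F n in sequentially. norm ((\<Sum>i<n. d i) / real n)
        \<le> \<bar>(\<Sum>i<(k n)\<^sup>2. d i) / real ((k n)\<^sup>2)\<bar> + 3 * K / real (k n)"
      using eventually_ge_at_top[of 1]
    proof eventually_elim
      case (elim n)
      have kpos: "k n > 0" using k_gt[of n] elim by (cases "k n") auto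
      have "{..<n} = {..<(k n)\<^sup>2} \<union> {(k n)\<^sup>2..<n}" using k_le[of n] by auto
      then have "(\<Sum>i<n. d i) = (\<Sum>i<(k n)\<^sup>2. d i) + (\<Sum>i=(k n)\<^sup>2..<n. d i)"
        by (metis finite_atLeastLessThan finite_lessThan ivl_disj_int_one(2) sum.union_disjoint)
      moreover have "\<bar>\<Sum>i=(k n)\<^sup>2..<n. d i\<bar> \<le> real (n - (k n)\<^sup>2) * K"
        using sum_norm_bound[of "{(k n)\<^sup>2..<n}" d K] bound by simp
      \<comment> \<open>Since n < (k + 1)^2, at most 2k terms remain; 3k is a generous
        bound.\<close>
      moreover have "real (n - (k n)\<^sup>2) * K \<le> real (3 * k n) * K"
        using k_gt[of n] kpos K0 by (intro mult_right_mono) (auto simp: power2_eq_square)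
      ultimately have "\<bar>\<Sum>i<n. d i\<bar> \<le> \<bar>\<Sum>i<(k n)\<^sup>2. d i\<bar> + 3 * real (k n) * K" by simp
      then have "\<bar>\<Sum>i<n. d i\<bar> / real n \<le> (\<bar>\<Sum>i<(k n)\<^sup>2. d i\<bar> + 3 * real (k n) * K) / real ((k n)\<^sup>2)"
        using k_le[of n] kpos elim K0 by (intro frac_le) (auto simp flip: of_nat_power)
      also have "\<dots> = \<bar>(\<Sum>i<(k n)\<^sup>2. d i) / real ((k n)\<^sup>2)\<bar> + 3 * K / real (k n)"
        using kpos by (simp add: add_divide_distrib power2_eq_square)
      finally show ?case by simp
    qed
  qed
qed

locale iid_sequence = prob_space M for M :: "'w measure" +
  fixes q :: "'z::finite pmf" and \<zeta> :: "nat \<Rightarrow> 'w \<Rightarrow> 'z"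
  assumes indep: "indep_vars (\<lambda>_. count_space UNIV) \<zeta> UNIV"
    and law: "prob {\<omega> \<in> space M. \<zeta> n \<omega> = a} = pmf q a"
begin

lemma measurable_zeta [measurable]: "\<zeta> n \<in> measurable M (count_space UNIV)"
  using indep by (auto simp: indep_vars_def)

lemma prob_word:
  assumes "length xs = n"
  shows "prob {\<omega> \<in> space M. map (\<lambda>i. \<zeta> i \<omega>) [0..<n] = xs} = prod_list (map (pmf q) xs)"
proof (cases "n = 0")
  case True
  then show ?thesis using assms by (simp add: prob_space)
next
  case False
  have "{\<omega> \<in> space M. map (\<lambda>i. \<zeta> i \<omega>) [0..<n] = xs} = (\<Inter>i\<in>{..<n}. \<zeta> i -` {xs ! i} \<inter> space M)"
    using assms False by (auto simp: list_eq_iff_nth_eq)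
  also have "prob \<dots> = (\<Prod>i<n. prob (\<zeta> i -` {xs ! i} \<inter> space M))"
    using False by (intro indep_varsD[OF indep]) auto
  also have "\<dots> = (\<Prod>i<n. pmf q (xs ! i))"
    by (intro prod.cong refl) (simp add: law vimage_def Int_def conj_commute)
  also have "\<dots> = prod_list (map (pmf q) xs)"
    using assms by (auto simp: prod_list_map_eq_prod_nth)
  finally show ?thesis .
qed

lemma measurable_word [measurable]:
  "(\<lambda>\<omega>. map (\<lambda>i. \<zeta> i \<omega>) [0..<n]) \<in> measurable M (count_space UNIV)"
  by (induction n) auto

lemma nn_integral_word:
  assumes "\<And>xs. 0 \<le> f xs"
  shows "(\<integral>\<^sup>+\<omega>. ennreal (f (map (\<lambda>i. \<zeta> i \<omega>) [0..<n])) \<partial>M) = ennreal (word_mean q n f)"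
proof -
  let ?W = "\<lambda>xs. {\<omega> \<in> space M. map (\<lambda>i. \<zeta> i \<omega>) [0..<n] = xs}"
  have fin: "finite {xs :: 'z list. length xs = n}"
    using finite_lists_length_eq[of "UNIV :: 'z set" n] by simp
  have meas: "?W xs \<in> sets M" for xs by measurable
  have "(\<integral>\<^sup>+\<omega>. ennreal (f (map (\<lambda>i. \<zeta> i \<omega>) [0..<n])) \<partial>M) =
      (\<integral>\<^sup>+\<omega>. (\<Sum>xs | length xs = n. ennreal (f xs) * indicator (?W xs) \<omega>) \<partial>M)"
  proof (intro nn_integral_cong)
    fix \<omega> assume "\<omega> \<in> space M"
    then have "(\<Sum>xs | length xs = n. ennreal (f xs) * indicator (?W xs) \<omega>) =
        (\<Sum>xs | length xs = n. if map (\<lambda>i. \<zeta> i \<omega>) [0..<n] = xs then ennreal (f xs) else 0)"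
      by (intro sum.cong) auto
    also have "\<dots> = ennreal (f (map (\<lambda>i. \<zeta> i \<omega>) [0..<n]))"
      by (subst sum.delta'[OF fin]) simp
    finally show "ennreal (f (map (\<lambda>i. \<zeta> i \<omega>) [0..<n])) =
        (\<Sum>xs | length xs = n. ennreal (f xs) * indicator (?W xs) \<omega>)" by simp
  qed
  also have "\<dots> = (\<Sum>xs | length xs = n. ennreal (f xs) * emeasure M (?W xs))"
    by (subst nn_integral_sum) (auto intro!: sum.cong nn_integral_cmult_indicator meas)
  also have "\<dots> = (\<Sum>xs | length xs = n. ennreal (prod_list (map (pmf q) xs) * f xs))"
    using assms
    by (intro sum.cong refl)
      (auto simp: emeasure_eq_measure prob_word ennreal_mult' mult.commute prod_list_nonneg)
  also have "\<dots> = ennreal (word_mean q n f)"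
    unfolding word_mean_def using assms
    by (intro sum_ennreal) (auto intro!: mult_nonneg_nonneg prod_list_nonneg)
  finally show ?thesis .
qed

text \<open>The second moment of the average over k^2 steps is at most K^2 / k^2, which is summable.
  So the sum of the squared averages has finite expectation, is finite almost surely, and its terms
  tend to 0.\<close>

theorem AE_averages_tendsto_0:
  assumes mean: "\<And>x. (\<Sum>z\<in>UNIV. pmf q z * \<phi> x z) = 0"
    and bound: "\<And>x z. \<bar>\<phi> x z\<bar> \<le> K"
  shows "AE \<omega> in M. (\<lambda>n. (\<Sum>k<n. \<phi> (state step x (\<lambda>i. \<zeta> i \<omega>) k) (\<zeta> k \<omega>)) / real n) \<longlonglongrightarrow> 0"
proof -
  define T where "T n \<omega> = (\<Sum>k<n. \<phi> (state step x (\<lambda>i. \<zeta> i \<omega>) k) (\<zeta> k \<omega>))" for n \<omega>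
  have T_word: "T n \<omega> = path_sum step \<phi> x (map (\<lambda>i. \<zeta> i \<omega>) [0..<n])" for n \<omega>
    by (simp add: T_def path_sum_eq_sum_state)
  have meas [measurable]: "T n \<in> borel_measurable M" for n
    unfolding T_word by (rule measurable_compose[OF measurable_word]) simp
  have le: "(\<integral>\<^sup>+\<omega>. ennreal ((T (k\<^sup>2) \<omega> / real (k\<^sup>2))\<^sup>2) \<partial>M) \<le> ennreal (K\<^sup>2 * inverse (real k ^ 2))" for k
  proof -
    have "(\<integral>\<^sup>+\<omega>. ennreal ((T (k\<^sup>2) \<omega> / real (k\<^sup>2))\<^sup>2) \<partial>M) =
        ennreal (word_mean q (k\<^sup>2) (\<lambda>zs. (path_sum step \<phi> x zs / real (k\<^sup>2))\<^sup>2))"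
      unfolding T_word by (rule nn_integral_word) simp
    also have "word_mean q (k\<^sup>2) (\<lambda>zs. (path_sum step \<phi> x zs / real (k\<^sup>2))\<^sup>2) =
        inverse ((real (k\<^sup>2))\<^sup>2) * word_mean q (k\<^sup>2) (\<lambda>zs. (path_sum step \<phi> x zs)\<^sup>2)"
      by (subst word_mean_cmult[symmetric]) (simp add: power_divide field_simps)
    also have "ennreal \<dots> \<le> ennreal (inverse ((real (k\<^sup>2))\<^sup>2) * (real (k\<^sup>2) * K\<^sup>2))"
      by (intro ennreal_leI mult_left_mono word_mean_path_sum_square_le[OF mean bound]) auto
    also have "inverse ((real (k\<^sup>2))\<^sup>2) * (real (k\<^sup>2) * K\<^sup>2) = K\<^sup>2 * inverse (real k ^ 2)"
      by (cases "k = 0") (auto simp: field_simps power2_eq_square)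
    finally show ?thesis .
  qed
  have "summable (\<lambda>k. K\<^sup>2 * inverse (real k ^ 2))"
    by (intro summable_mult inverse_power_summable) simp
  then have "(\<Sum>k. ennreal (K\<^sup>2 * inverse (real k ^ 2))) \<noteq> \<infinity>"
    by (subst suminf_ennreal2) auto
  moreover have "(\<integral>\<^sup>+\<omega>. (\<Sum>k. ennreal ((T (k\<^sup>2) \<omega> / real (k\<^sup>2))\<^sup>2)) \<partial>M) \<le>
      (\<Sum>k. ennreal (K\<^sup>2 * inverse (real k ^ 2)))"
    by (subst nn_integral_suminf) (use le in \<open>auto intro!: suminf_le\<close>)
  ultimately have "(\<integral>\<^sup>+\<omega>. (\<Sum>k. ennreal ((T (k\<^sup>2) \<omega> / real (k\<^sup>2))\<^sup>2)) \<partial>M) \<noteq> \<infinity>"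
    by (auto simp: top_unique)
  then have "AE \<omega> in M. (\<Sum>k. ennreal ((T (k\<^sup>2) \<omega> / real (k\<^sup>2))\<^sup>2)) \<noteq> \<infinity>"
    by (intro nn_integral_PInf_AE) auto
  then show ?thesis
  proof eventually_elim
    case (elim \<omega>)
    then have "summable (\<lambda>k. (T (k\<^sup>2) \<omega> / real (k\<^sup>2))\<^sup>2)"
      by (intro summable_suminf_not_top) auto
    then have "(\<lambda>k. (T (k\<^sup>2) \<omega> / real (k\<^sup>2))\<^sup>2) \<longlonglongrightarrow> 0"
      by (rule summable_LIMSEQ_zero)
    then have "(\<lambda>k. T (k\<^sup>2) \<omega> / real (k\<^sup>2)) \<longlonglongrightarrow> 0"
      by (simp only: power_tendsto_0_iff[OF pos2])
    then show ?case
      unfolding T_def by (rule averages_tendsto_0_if_square_subsequence) (rule bound)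
  qed
qed

end

section \<open>Visit frequencies of a stationary chain\<close>

locale stationary_chain =
  fixes q :: "'z::finite pmf" and step :: "'x \<Rightarrow> 'z \<Rightarrow> 'x" and \<pi> :: "'x pmf" and e :: 'x
  assumes invariant: "bind_pmf \<pi> (\<lambda>x. map_pmf (step x) q) = \<pi>"
    and e_pos: "pmf \<pi> e > 0"
begin

definition next_mean :: "('x \<Rightarrow> real) \<Rightarrow> 'x \<Rightarrow> real" where
  "next_mean g x = (\<Sum>z\<in>UNIV. pmf q z * g (step x z))"

lemma next_mean_const [simp]: "next_mean (\<lambda>_. c) x = c"
  by (simp add: next_mean_def sum_pmf_eq_1 flip: sum_distrib_right)

lemma next_mean_mono: "(\<And>z. g (step x z) \<le> h (step x z)) \<Longrightarrow> next_mean g x \<le> next_mean h x"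
  unfolding next_mean_def by (intro sum_mono mult_left_mono) auto

lemma next_mean_diff: "next_mean (\<lambda>x. g x - h x) x = next_mean g x - next_mean h x"
  by (simp add: next_mean_def right_diff_distrib sum_subtractf)

lemma next_mean_add: "next_mean (\<lambda>x. g x + h x) x = next_mean g x + next_mean h x"
  by (simp add: next_mean_def distrib_left sum.distrib)

lemma next_mean_centred: "(\<Sum>z\<in>UNIV. pmf q z * (g (step x z) - next_mean g x)) = 0"
  by (simp add: right_diff_distrib sum_subtractf next_mean_def sum_pmf_eq_1 flip: sum_distrib_right)

lemma expectation_next_mean:
  assumes "\<And>x. 0 \<le> g x" "\<And>x. g x \<le> B"
  shows "measure_pmf.expectation \<pi> (next_mean g) = measure_pmf.expectation \<pi> g"
proof -
  have "(\<integral>\<^sup>+x. ennreal (g x) \<partial>measure_pmf \<pi>) =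
      (\<integral>\<^sup>+x. (\<integral>\<^sup>+y. ennreal (g y) \<partial>measure_pmf (map_pmf (step x) q)) \<partial>measure_pmf \<pi>)"
    by (subst invariant[symmetric]) (rule nn_integral_bind_pmf)
  also have "(\<lambda>x. \<integral>\<^sup>+y. ennreal (g y) \<partial>measure_pmf (map_pmf (step x) q)) =
      (\<lambda>x. ennreal (next_mean g x))"
  proof
    fix x
    have "(\<integral>\<^sup>+y. ennreal (g y) \<partial>measure_pmf (map_pmf (step x) q)) =
        (\<Sum>z\<in>UNIV. ennreal (g (step x z)) * ennreal (pmf q z))"
      by (simp, rule nn_integral_measure_pmf_support) auto
    also have "\<dots> = ennreal (next_mean g x)"
      unfolding next_mean_def using assms(1)
      by (subst sum_ennreal[symmetric]) (auto simp: ennreal_mult' mult.commute)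
    finally show "(\<integral>\<^sup>+y. ennreal (g y) \<partial>measure_pmf (map_pmf (step x) q)) = ennreal (next_mean g x)" .
  qed
  finally have "(\<integral>\<^sup>+x. ennreal (g x) \<partial>measure_pmf \<pi>) = (\<integral>\<^sup>+x. ennreal (next_mean g x) \<partial>measure_pmf \<pi>)" .
  moreover have "0 \<le> next_mean g x" for x
    using assms(1) by (auto simp: next_mean_def intro!: sum_nonneg)
  ultimately show ?thesis
    using assms(1) by (simp add: integral_eq_nn_integral)
qed

text \<open>\<open>cost f n x\<close> is the expectation of the sum of \<open>f\<close> over the first \<open>n\<close> states of the
  chain from \<open>x\<close>, stopped on reaching \<open>e\<close>.\<close>

primrec cost :: "('x \<Rightarrow> real) \<Rightarrow> nat \<Rightarrow> 'x \<Rightarrow> real" where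
  "cost f 0 x = 0"
| "cost f (Suc n) x = (if x = e then 0 else f x + next_mean (cost f n) x)"

abbreviation hit_time :: "nat \<Rightarrow> 'x \<Rightarrow> real" where
  "hit_time \<equiv> cost (\<lambda>_. 1)"

lemma next_mean_cost_0 [simp]: "next_mean (cost f 0) x = 0"
  by (simp add: next_mean_def)

lemma cost_e [simp]: "cost f n e = 0"
  by (cases n) auto

context
  fixes f :: "'x \<Rightarrow> real"
  assumes f_nonneg: "\<And>x. 0 \<le> f x" and f_le_1: "\<And>x. f x \<le> 1"
begin

lemma cost_nonneg: "0 \<le> cost f n x"
proof (induction n arbitrary: x)
  case (Suc n)
  have "0 \<le> next_mean (cost f n) x"
    using next_mean_mono[of "\<lambda>_. 0" x "cost f n"] Suc by simp
  then show ?case using f_nonneg[of x] by simp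
qed simp

lemma cost_le: "cost f n x \<le> real n"
proof (induction n arbitrary: x)
  case (Suc n)
  have "next_mean (cost f n) x \<le> real n"
    using next_mean_mono[of "cost f n" x "\<lambda>_. real n"] Suc by simp
  then show ?case using f_le_1[of x] by simp
qed simp

lemma cost_Suc_ge: "cost f n x \<le> cost f (Suc n) x"
proof (induction n arbitrary: x)
  case 0
  show ?case by (simp add: f_nonneg)
next
  case (Suc n)
  have "next_mean (cost f n) x \<le> next_mean (cost f (Suc n)) x"
    by (intro next_mean_mono Suc)
  then show ?case by simp
qed

text \<open>The increment is the expected value of f at the state after n steps, on the event that
  \<open>e\<close> has not been met up to then. With 1 in place of f it is the probability of that
  event.\<close>

lemma cost_increment_le: "cost f (Suc n) x - cost f n x \<le> hit_time (Suc n) x - hit_time n x"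
proof (induction n arbitrary: x)
  case 0
  show ?case by (simp add: f_le_1)
next
  case (Suc n)
  have "next_mean (\<lambda>y. cost f (Suc n) y - cost f n y) x
      \<le> next_mean (\<lambda>y. hit_time (Suc n) y - hit_time n y) x"
    by (intro next_mean_mono Suc)
  then show ?case
    using cost.simps(2)[of f "Suc n" x] cost.simps(2)[of f n x]
      cost.simps(2)[of "\<lambda>_. 1" "Suc n" x] cost.simps(2)[of "\<lambda>_. 1" n x]
    unfolding next_mean_diff by (simp del: cost.simps)
qed

text \<open>Away from \<open>e\<close> this is the recursion for \<open>cost\<close> rearranged. At
  \<open>e\<close>, where \<open>cost\<close> vanishes, the indicator term cancels
  \<open>- f e\<close> and supplies the value, so one formula can be integrated over all
  states.\<close>

lemma next_mean_cost:
  "next_mean (cost f n) x =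
     cost f (Suc n) x - f x + indicator {e} x * (f e + next_mean (cost f n) e)"
  by (auto simp: indicator_def)

lemma next_mean_cost_bounds: "0 \<le> next_mean (cost f n) x" "next_mean (cost f n) x \<le> real n"
  using next_mean_mono[of "\<lambda>_. 0" x "cost f n"] next_mean_mono[of "cost f n" x "\<lambda>_. real n"]
    cost_nonneg cost_le by simp_all

text \<open>Integrate \<open>next_mean_cost\<close> against \<pi>; by invariance
  \<open>next_mean (cost f n)\<close> and \<open>cost f n\<close> have the same mean. The bracket on
  the left is the expected sum of f over an excursion from \<open>e\<close>, cut off after n + 1
  states, so this is Kac's formula with an explicit truncation error.\<close>

lemma kac:
  "pmf \<pi> e * (f e + next_mean (cost f n) e) =
    measure_pmf.expectation \<pi> f - measure_pmf.expectation \<pi> (\<lambda>x. cost f (Suc n) x - cost f n x)"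
proof -
  have int: "integrable (measure_pmf \<pi>) g" if "\<And>x. 0 \<le> g x" "\<And>x. g x \<le> B" for g :: "'x \<Rightarrow> real" and B
    by (rule measure_pmf.integrable_const_bound[where B = B]) (use that in \<open>auto simp: abs_of_nonneg\<close>)
  have int_f: "integrable (measure_pmf \<pi>) f"
    by (rule int) (fact f_nonneg f_le_1)+
  have int_c: "integrable (measure_pmf \<pi>) (cost f n)" for n
    by (rule int) (fact cost_nonneg cost_le)+
  have "measure_pmf.expectation \<pi> (cost f n) = measure_pmf.expectation \<pi> (next_mean (cost f n))"
    by (rule expectation_next_mean[symmetric]) (fact cost_nonneg cost_le)+
  also have "\<dots> = measure_pmf.expectation \<pi>
      (\<lambda>x. cost f (Suc n) x - f x + indicator {e} x * (f e + next_mean (cost f n) e))"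
    by (intro Bochner_Integration.integral_cong refl next_mean_cost)
  also have "\<dots> = measure_pmf.expectation \<pi> (cost f (Suc n)) - measure_pmf.expectation \<pi> f +
      pmf \<pi> e * (f e + next_mean (cost f n) e)"
  proof -
    have "integrable (measure_pmf \<pi>) (\<lambda>x. indicat_real {e} x * (f e + next_mean (cost f n) e))"
      by (intro integrable_mult_left integrable_real_indicator) (auto simp: less_top[symmetric])
    then show ?thesis
      using int_f int_c[of "Suc n"]
      by (simp del: cost.simps add: Bochner_Integration.integral_add Bochner_Integration.integral_diff
        Bochner_Integration.integrable_diff measure_pmf_single)
  qed
  finally show ?thesis using int_c by (simp del: cost.simps)
qed

lemma kac_le: "pmf \<pi> e * (f e + next_mean (cost f n) e) \<le> measure_pmf.expectation \<pi> f"
  unfolding kac using cost_Suc_ge by (simp del: cost.simps add: integral_nonneg_AE)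

end

text \<open>For f = 1 the bracket in \<open>kac_le\<close> is a truncated mean return time, at most
  \<open>1 / pmf \<pi> e\<close>; the step out of \<open>e\<close> accounts for the subtracted
  1.\<close>

lemma next_mean_hit_time_le: "next_mean (hit_time n) e \<le> 1 / pmf \<pi> e - 1"
  using kac_le[of "\<lambda>_. 1" n] e_pos by (simp add: field_simps)

text \<open>The truncation error is the \<pi>-mean of the increments of \<open>cost\<close>, which
  lie between 0 and those of \<open>hit_time\<close>. The latter never exceed 1 and tend to 0
  because the mean hitting times are finite, so dominated convergence applies.\<close>

lemma kac_limit:
  assumes f: "\<And>x. 0 \<le> f x" "\<And>x. f x \<le> 1"
    and bdd: "\<And>x. bdd_above (range (\<lambda>n. hit_time n x))"
  shows "(\<lambda>n. pmf \<pi> e * (f e + next_mean (cost f n) e)) \<longlonglongrightarrow> measure_pmf.expectation \<pi> f"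
proof -
  have "(\<lambda>n. hit_time n x) \<longlonglongrightarrow> (SUP n. hit_time n x)" for x
    using bdd[of x] by (intro LIMSEQ_incseq_SUP incseq_SucI cost_Suc_ge) auto
  then have tendsto: "(\<lambda>n. hit_time (Suc n) x - hit_time n x) \<longlonglongrightarrow> 0" for x
    using tendsto_diff[OF LIMSEQ_Suc] by fastforce
  have "(\<lambda>n. measure_pmf.expectation \<pi> (\<lambda>x. cost f (Suc n) x - cost f n x)) \<longlonglongrightarrow>
      measure_pmf.expectation \<pi> (\<lambda>x. 0)"
  proof (rule integral_dominated_convergence[where w = "\<lambda>_. 1"])
    have lim: "(\<lambda>n. cost f (Suc n) x - cost f n x) \<longlonglongrightarrow> 0" for x
      by (rule tendsto_sandwich[OF always_eventually always_eventually tendsto_const tendsto[of x]])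
        (auto simp del: cost.simps simp: cost_Suc_ge[where f = f, OF f] cost_increment_le[where f = f, OF f])
    then show "AE x in measure_pmf \<pi>. (\<lambda>n. cost f (Suc n) x - cost f n x) \<longlonglongrightarrow> 0"
      by blast
    fix n
    have "hit_time (Suc n) x - hit_time n x \<le> 1" for x
    proof (induction n arbitrary: x)
      case (Suc n)
      have "next_mean (\<lambda>y. hit_time (Suc n) y - hit_time n y) x \<le> next_mean (\<lambda>_. 1) x"
        by (intro next_mean_mono Suc)
      then show ?case
        using cost.simps(2)[of "\<lambda>_. 1" "Suc n" x] cost.simps(2)[of "\<lambda>_. 1" n x]
        unfolding next_mean_diff by (simp del: cost.simps)
    qed simp
    then show "AE x in measure_pmf \<pi>. norm (cost f (Suc n) x - cost f n x) \<le> 1"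
      using cost_Suc_ge[where f = f, OF f, of n] cost_increment_le[where f = f, OF f, of n]
      by (intro always_eventually allI) (smt (verit) real_norm_def)
  qed auto
  then show ?thesis
    unfolding kac[where f = f, OF f] using tendsto_diff[OF tendsto_const] by fastforce
qed

end

text \<open>Both assumptions bound truncated hitting times uniformly in n; in the limit they give a
  finite Lyapunov function with increments at most L.\<close>

locale iid_stationary_chain = iid_sequence M q \<zeta> + stationary_chain q step \<pi> e
  for M :: "'w measure" and q :: "'z::finite pmf" and \<zeta> and step :: "'x \<Rightarrow> 'z \<Rightarrow> 'x" and \<pi> e +
  fixes L :: real
  assumes hit_time_bdd: "bdd_above (range (\<lambda>n. hit_time n x))"
    and hit_time_step: "\<bar>hit_time n (step x z) - hit_time n x\<bar> \<le> L"
begin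

definition freq :: "'x \<Rightarrow> 'x set \<Rightarrow> 'w \<Rightarrow> nat \<Rightarrow> real" where
  "freq x E \<omega> n = (\<Sum>k<n. indicator E (state step x (\<lambda>i. \<zeta> i \<omega>) k)) / real n"

lemma real_n_mult_freq:
  "n > 0 \<Longrightarrow> real n * freq x E \<omega> n = (\<Sum>k<n. indicator E (state step x (\<lambda>i. \<zeta> i \<omega>) k))"
  by (simp add: freq_def)

lemma AE_next_mean_averages:
  assumes "\<And>x z. \<bar>g (step x z) - next_mean g x\<bar> \<le> K"
  shows "AE \<omega> in M. (\<lambda>n. (\<Sum>k<n. g (state step x (\<lambda>i. \<zeta> i \<omega>) (Suc k)) -
    next_mean g (state step x (\<lambda>i. \<zeta> i \<omega>) k)) / real n) \<longlonglongrightarrow> 0"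
  using AE_averages_tendsto_0[where \<phi> = "\<lambda>x z. g (step x z) - next_mean g x" and step = step, OF _ assms]
  by (simp add: next_mean_centred)

text \<open>On average V falls by 1 per step away from \<open>e\<close> and rises by at most
  \<open>1 / pmf \<pi> e - 1\<close> at \<open>e\<close>. Over n steps the martingale part is o(n)
  and V stays nonnegative, so the rises, that is the visits to \<open>e\<close>, must make up for n
  falls.\<close>

lemma AE_freq_e_ge:
  "AE \<omega> in M. \<forall>\<epsilon>>0. \<forall>\<^sub>F n in sequentially. freq x {e} \<omega> n \<ge> pmf \<pi> e - \<epsilon>"
proof -
  define V where "V x = (SUP n. hit_time n x)" for x
  have lim: "(\<lambda>n. hit_time n x) \<longlonglongrightarrow> V x" for x
    unfolding V_def using hit_time_bdd[of x]
    by (intro LIMSEQ_incseq_SUP incseq_SucI cost_Suc_ge) auto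
  have lim_next: "(\<lambda>n. next_mean (hit_time n) x) \<longlonglongrightarrow> next_mean V x" for x
    unfolding next_mean_def by (intro tendsto_intros lim)
  have V_step: "\<bar>V (step x z) - V x\<bar> \<le> L" for x z
    by (rule LIMSEQ_le_const2[OF tendsto_rabs[OF tendsto_diff[OF lim lim]]])
      (use hit_time_step in auto)
  have V_nonneg: "0 \<le> V x" for x
    by (rule LIMSEQ_le_const[OF lim]) (use cost_nonneg in auto)
  have V_drift: "next_mean V x \<le> V x - 1 + indicator {e} x / pmf \<pi> e" for x
  proof (cases "x = e")
    case True
    have "next_mean V e \<le> 1 / pmf \<pi> e - 1"
      by (rule LIMSEQ_le_const2[OF lim_next]) (use next_mean_hit_time_le in auto)
    moreover have "V e = 0" by (simp add: V_def)
    ultimately show ?thesis using True by simp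
  next
    case False
    have "(\<lambda>n. hit_time (Suc n) x) \<longlonglongrightarrow> 1 + next_mean V x"
      using False lim_next[of x] by (auto intro: tendsto_add)
    then have "V x = 1 + next_mean V x"
      using LIMSEQ_unique LIMSEQ_Suc[OF lim] by blast
    then show ?thesis using False by simp
  qed
  \<comment> \<open>Both values lie within L of \<open>V x\<close>.\<close>
  have "\<bar>V (step x z) - next_mean V x\<bar> \<le> L + L" for x z
  proof -
    have "next_mean (\<lambda>_. V x - L) x \<le> next_mean V x" "next_mean V x \<le> next_mean (\<lambda>_. V x + L) x"
      using V_step[of x] by (intro next_mean_mono; smt (verit))+
    then show ?thesis using V_step[of x z] by (simp add: abs_le_iff)
  qed
  from AE_next_mean_averages[where g = V, OF this, of x]
  show ?thesis
  proof eventually_elim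
    case (elim \<omega>)
    let ?X = "state step x (\<lambda>i. \<zeta> i \<omega>)"
    define A where "A n = (\<Sum>k<n. V (?X (Suc k)) - next_mean V (?X k)) / real n" for n
    have A: "A \<longlonglongrightarrow> 0" using elim by (simp add: A_def[abs_def])
    have "(\<lambda>n. pmf \<pi> e * (1 - V x / real n - A n)) \<longlonglongrightarrow> pmf \<pi> e * (1 - 0 - 0)"
      by (intro tendsto_intros A lim_const_over_n)
    then have lim: "(\<lambda>n. pmf \<pi> e * (1 - V x / real n - A n)) \<longlonglongrightarrow> pmf \<pi> e" by simp
    have ge: "freq x {e} \<omega> n \<ge> pmf \<pi> e * (1 - V x / real n - A n)" if "n > 0" for n
    proof -
      have "real n * A n \<ge> (\<Sum>k<n. V (?X (Suc k)) - (V (?X k) - 1 + indicator {e} (?X k) / pmf \<pi> e))"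
        using that V_drift by (auto simp: A_def intro!: sum_mono diff_left_mono)
      also have "(\<Sum>k<n. V (?X (Suc k)) - (V (?X k) - 1 + indicator {e} (?X k) / pmf \<pi> e)) =
          (\<Sum>k<n. V (?X (Suc k)) - V (?X k)) + real n - real n * freq x {e} \<omega> n / pmf \<pi> e"
        using that
        by (simp add: real_n_mult_freq sum.distrib sum_subtractf flip: sum_divide_distrib)
      also have "(\<Sum>k<n. V (?X (Suc k)) - V (?X k)) = V (?X n) - V x"
        by (subst sum_lessThan_telescope) simp
      finally have "real n * A n \<ge> - V x + real n - real n * freq x {e} \<omega> n / pmf \<pi> e"
        using V_nonneg[of "?X n"] by linarith
      then show ?thesis using that e_pos by (simp add: field_simps)
    qed
    show ?case
    proof (intro allI impI)
      fix \<epsilon> :: real assume "\<epsilon> > 0"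
      then have "\<forall>\<^sub>F n in sequentially. pmf \<pi> e - \<epsilon> < pmf \<pi> e * (1 - V x / real n - A n)"
        by (intro order_tendstoD(1)[OF lim]) simp
      then show "\<forall>\<^sub>F n in sequentially. freq x {e} \<omega> n \<ge> pmf \<pi> e - \<epsilon>"
        using eventually_gt_at_top[of 0]
      proof eventually_elim
        case (elim n)
        then show ?case using ge[of n] by argo
      qed
    qed
  qed
qed

text \<open>For fixed m the truncated cost \<open>g m\<close> lies between 0 and m, so its
  telescoping sum is negligible and its martingale part averages out. Up to o(1), the frequency of E
  is then at least the frequency of \<open>e\<close> times the truncated excursion sum
  \<open>a m\<close>, and by \<open>kac_limit\<close> the product \<open>pmf \<pi> e * a m\<close>
  is close to the \<pi>-measure of E for large m.\<close>

lemma AE_freq_ge: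
  "AE \<omega> in M. \<forall>\<epsilon>>0. \<forall>\<^sub>F n in sequentially. freq x E \<omega> n \<ge> measure \<pi> E - \<epsilon>"
proof -
  define g where "g n = cost (indicator E) n" for n
  note f = indicator_pos_le[of E] indicator_le_1[of E]
  \<comment> \<open>The truncation m is chosen after \<omega>, according to \<epsilon>, so one null
    set has to serve all m.\<close>
  have "AE \<omega> in M. \<forall>m. (\<lambda>n. (\<Sum>k<n. g m (state step x (\<lambda>i. \<zeta> i \<omega>) (Suc k)) -
    next_mean (g m) (state step x (\<lambda>i. \<zeta> i \<omega>) k)) / real n) \<longlonglongrightarrow> 0"
    unfolding AE_all_countable
  proof
    fix m
    have "\<bar>g m (step x z) - next_mean (g m) x\<bar> \<le> real m + real m" for x z
      using cost_nonneg[where f = "indicator E", OF f, of m "step x z"] cost_le[where f = "indicator E", OF f, of m "step x z"]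
        next_mean_cost_bounds[where f = "indicator E", OF f, of m x]
      by (simp add: g_def abs_le_iff)
    from AE_next_mean_averages[where g = "g m", OF this]
    show "AE \<omega> in M. (\<lambda>n. (\<Sum>k<n. g m (state step x (\<lambda>i. \<zeta> i \<omega>) (Suc k)) -
      next_mean (g m) (state step x (\<lambda>i. \<zeta> i \<omega>) k)) / real n) \<longlonglongrightarrow> 0" .
  qed
  then show ?thesis
    using AE_freq_e_ge[of x]
  proof eventually_elim
    case (elim \<omega>)
    let ?X = "state step x (\<lambda>i. \<zeta> i \<omega>)"
    show ?case
    proof (intro allI impI)
      fix \<epsilon> :: real assume "\<epsilon> > 0"
      define a where "a m = indicator E e + next_mean (g m) e" for m
      have a_nonneg: "0 \<le> a m" for m
        using next_mean_cost_bounds[where f = "indicator E", OF f, of m e] by (simp add: a_def g_def)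
      have "(\<lambda>m. pmf \<pi> e * a m) \<longlonglongrightarrow> measure \<pi> E"
        using kac_limit[where f = "indicator E", OF f hit_time_bdd] by (simp add: a_def g_def)
      then have "\<forall>\<^sub>F m in sequentially. measure \<pi> E - \<epsilon> / 2 < pmf \<pi> e * a m"
        using \<open>\<epsilon> > 0\<close> by (intro order_tendstoD) auto
      then obtain m where m: "measure \<pi> E - \<epsilon> / 2 < pmf \<pi> e * a m"
        by (auto simp: eventually_sequentially)
      define A where "A n = (\<Sum>k<n. g m (?X (Suc k)) - next_mean (g m) (?X k)) / real n" for n
      have A: "A \<longlonglongrightarrow> 0" using elim by (simp add: A_def[abs_def])
      \<comment> \<open>The errors are \<epsilon>/2 from the choice of m, \<epsilon>/4 from
        martingale and boundary terms, and \<epsilon>/8 from the frequency of \<open>e\<close>.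
        Adding 1 in the denominator covers \<open>a m = 0\<close>.\<close>
      define \<delta> where "\<delta> = \<epsilon> / (8 * (a m + 1))"
      have "\<delta> > 0" and "a m * \<delta> \<le> \<epsilon> / 8"
        using \<open>\<epsilon> > 0\<close> a_nonneg[of m] by (auto simp: \<delta>_def field_simps)
      have "(\<lambda>n. A n - real m / real n) \<longlonglongrightarrow> 0 - 0"
        by (intro tendsto_intros A lim_const_over_n)
      then have "\<forall>\<^sub>F n in sequentially. - (\<epsilon> / 4) < A n - real m / real n"
        using \<open>\<epsilon> > 0\<close> by (intro order_tendstoD) auto
      moreover have "\<forall>\<^sub>F n in sequentially. freq x {e} \<omega> n \<ge> pmf \<pi> e - \<delta>"
        using elim \<open>\<delta> > 0\<close> by blast
      ultimately show "\<forall>\<^sub>F n in sequentially. freq x E \<omega> n \<ge> measure \<pi> E - \<epsilon>"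
        using eventually_gt_at_top[of 0]
      proof eventually_elim
        case (elim n)
        have "g m x - next_mean (g m) x + indicator {e} x * a m \<le> indicator E x" for x
          using next_mean_cost[where f = "indicator E", OF f, of m x] cost_Suc_ge[where f = "indicator E", OF f, of m x] by (simp add: a_def g_def)
        then have "real n * freq x E \<omega> n \<ge>
            (\<Sum>k<n. g m (?X k) - next_mean (g m) (?X k) + indicator {e} (?X k) * a m)"
          using elim by (auto simp: freq_def intro!: sum_mono)
        also have "(\<Sum>k<n. g m (?X k) - next_mean (g m) (?X k) + indicator {e} (?X k) * a m) =
            real n * A n - (\<Sum>k<n. g m (?X (Suc k)) - g m (?X k)) + real n * freq x {e} \<omega> n * a m"
          using elim by (simp add: A_def freq_def sum.distrib sum_subtractf sum_distrib_right)
        also have "(\<Sum>k<n. g m (?X (Suc k)) - g m (?X k)) = g m (?X n) - g m x"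
          by (subst sum_lessThan_telescope) simp
        finally have "real n * freq x E \<omega> n \<ge>
            real n * A n - (g m (?X n) - g m x) + real n * freq x {e} \<omega> n * a m" .
        moreover have "g m (?X n) - g m x \<le> real m"
          using cost_le[where f = "indicator E", OF f, of m "?X n"] cost_nonneg[where f = "indicator E", OF f, of m x] by (simp add: g_def)
        ultimately have "real n * freq x E \<omega> n \<ge>
            real n * (A n - real m / real n + freq x {e} \<omega> n * a m)"
          using elim by (simp add: algebra_simps)
        then have "freq x E \<omega> n \<ge> A n - real m / real n + freq x {e} \<omega> n * a m"
          using elim by simp
        moreover have "freq x {e} \<omega> n * a m \<ge> (pmf \<pi> e - \<delta>) * a m"
          using elim a_nonneg by (intro mult_right_mono) auto
        ultimately show ?case
          using elim m \<open>a m * \<delta> \<le> \<epsilon> / 8\<close> \<open>\<epsilon> > 0\<close> by (simp add: algebra_simps)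
      qed
    qed
  qed
qed

theorem AE_freq_tendsto: "AE \<omega> in M. freq x E \<omega> \<longlonglongrightarrow> measure \<pi> E"
  using AE_freq_ge[where x = x and E = E] AE_freq_ge[where x = x and E = "- E"]
proof eventually_elim
  case (elim \<omega>)
  have compl: "freq x (- E) \<omega> n = 1 - freq x E \<omega> n" if "n > 0" for n
  proof -
    have "real n * freq x (- E) \<omega> n = real n - real n * freq x E \<omega> n"
      unfolding real_n_mult_freq[OF that] by (simp add: indicator_compl sum_subtractf)
    also have "\<dots> = real n * (1 - freq x E \<omega> n)"
      by (simp add: right_diff_distrib)
    finally show ?thesis using that by simp
  qed
  have compl': "measure \<pi> (- E) = 1 - measure \<pi> E"
    using measure_pmf.prob_compl[of E \<pi>] by (simp add: Compl_eq_Diff_UNIV)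
  show ?case
  proof (rule order_tendstoI)
    fix a assume "a < measure \<pi> E"
    then have "\<forall>\<^sub>F n in sequentially. freq x E \<omega> n \<ge> measure \<pi> E - (measure \<pi> E - a) / 2"
      using elim by simp
    then show "\<forall>\<^sub>F n in sequentially. a < freq x E \<omega> n"
    proof eventually_elim
      case (elim n)
      then show ?case using \<open>a < measure \<pi> E\<close> by argo
    qed
  next
    fix a assume "measure \<pi> E < a"
    then have "\<forall>\<^sub>F n in sequentially. freq x (- E) \<omega> n \<ge> measure \<pi> (- E) - (a - measure \<pi> E) / 2"
      using elim by simp
    then show "\<forall>\<^sub>F n in sequentially. freq x E \<omega> n < a"
      using eventually_gt_at_top[of 0]
    proof eventually_elim
      case (elim n)
      then show ?case using \<open>measure \<pi> E < a\<close> compl[of n] compl' by argo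
    qed
  qed
qed

text \<open>The state at time k depends on earlier inputs only, so centring the indicator of the
  letter a at each fixed state gives a martingale difference; its average vanishes and the
  probability of a factors out.\<close>

theorem AE_joint_freq_tendsto:
  "AE \<omega> in M. (\<lambda>n. (\<Sum>k<n. indicator E (state step x (\<lambda>i. \<zeta> i \<omega>) k) * of_bool (\<zeta> k \<omega> = a)) / real n)
    \<longlonglongrightarrow> measure \<pi> E * pmf q a"
proof -
  define \<phi> :: "'x \<Rightarrow> 'z \<Rightarrow> real" where "\<phi> y z = indicator E y * (of_bool (z = a) - pmf q a)" for y z
  have mean: "(\<Sum>z\<in>UNIV. pmf q z * \<phi> y z) = 0" for y
  proof -
    have "(\<Sum>z\<in>UNIV. pmf q z * \<phi> y z) =
        indicator E y * (\<Sum>z\<in>UNIV. pmf q z * of_bool (z = a) - pmf q z * pmf q a)"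
      by (simp add: \<phi>_def sum_distrib_left algebra_simps)
    also have "(\<Sum>z\<in>UNIV. pmf q z * of_bool (z = a) - pmf q z * pmf q a) = 0"
      by (simp add: sum_subtractf of_bool_def mult_delta_right sum_pmf_eq_1 flip: sum_distrib_right)
    finally show ?thesis by simp
  qed
  have "\<bar>\<phi> y z\<bar> \<le> 1" for y z
    using pmf_le_1[of q a] order_trans[OF _ pmf_nonneg[of q a], of "- 1"]
    by (auto simp: \<phi>_def indicator_def abs_le_iff)
  from AE_averages_tendsto_0[where \<phi> = \<phi> and step = step and x = x, OF mean this]
    AE_freq_tendsto[where x = x and E = E]
  show ?thesis
  proof eventually_elim
    case (elim \<omega>)
    from tendsto_add[OF elim(1) tendsto_mult[OF elim(2) tendsto_const[of "pmf q a"]]]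
    show ?case
      by (simp add: \<phi>_def freq_def right_diff_distrib sum_subtractf diff_divide_distrib flip: sum_distrib_right)
  qed
qed

end

section \<open>The product-form weights of the queue\<close>

primrec remove_first :: "('a \<Rightarrow> bool) \<Rightarrow> 'a list \<Rightarrow> 'a list" where
  "remove_first P [] = []"
| "remove_first P (x # xs) = (if P x then xs else x # remove_first P xs)"

lemma remove_first_append:
  "remove_first P (xs @ ys) = (if \<exists>x\<in>set xs. P x then remove_first P xs @ ys else xs @ remove_first P ys)"
  by (induction xs) auto

lemma remove_first_cases:
  obtains (none) "\<forall>x\<in>set xs. \<not> P x" "remove_first P xs = xs"
  | (some) a d b where "xs = a @ d # b" "remove_first P xs = a @ b"
proof (cases "\<exists>x\<in>set xs. P x")
  case True
  then obtain a d b where "xs = a @ d # b" "P d" "\<forall>x\<in>set a. \<not> P x"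
    by (auto dest!: split_list_first_prop)
  then show thesis by (intro some) (auto simp: remove_first_append)
next
  case False
  then show thesis using remove_first_append[of P xs "[]"] by (intro none) auto
qed

text \<open>One step of a coupling: two lists that differ by an extra agent receive the same good,
  and afterwards agree or again differ by one agent. If the good takes d itself from the longer
  list, the agent it takes from the shorter one becomes the extra agent. The inclusion of sets
  records that the extra agent only moves backwards, so no new types appear from it onwards.\<close>

lemma remove_first_insert:
  "remove_first P (a @ d # b) = remove_first P (a @ b) \<or>
    (\<exists>a' d' b'. remove_first P (a @ d # b) = a' @ d' # b' \<and> remove_first P (a @ b) = a' @ b' \<and>
      set (d' # b') \<subseteq> set (d # b))"
proof (cases "\<exists>x\<in>set a. P x")
  case True
  then have "remove_first P (a @ d # b) = remove_first P a @ d # b"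
    "remove_first P (a @ b) = remove_first P a @ b"
    by (auto simp: remove_first_append)
  then show ?thesis by blast
next
  case a: False
  show ?thesis
  proof (cases "P d")
    case d: True
    show ?thesis
    proof (cases rule: remove_first_cases[where xs = b and P = P])
      case none
      then show ?thesis using a d by (auto simp: remove_first_append)
    next
      case (some b1 e b2)
      then have "remove_first P (a @ d # b) = (a @ b1) @ e # b2" "remove_first P (a @ b) = (a @ b1) @ b2"
        using a d by (auto simp: remove_first_append)
      moreover have "set (e # b2) \<subseteq> set (d # b)" using some by auto
      ultimately show ?thesis by blast
    qed
  next
    case False
    have "set (remove_first P b) \<subseteq> set b"
      by (cases rule: remove_first_cases[where xs = b and P = P]) auto
    then have "set (d # remove_first P b) \<subseteq> set (d # b)" by auto
    moreover have "remove_first P (a @ d # b) = a @ d # remove_first P b"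
      "remove_first P (a @ b) = a @ remove_first P b"
      using a False by (auto simp: remove_first_append)
    ultimately show ?thesis by blast
  qed
qed

text \<open>For \<open>C = {}\<close> this is the ordering \<open>(C\<^sub>1, \<dots>, C\<^sub>k)\<close> whose distribution is \<open>\<pi>\<^sub>Y\<close>.\<close>

primrec fresh :: "'a set \<Rightarrow> 'a list \<Rightarrow> 'a list" where
  "fresh C [] = []"
| "fresh C (a # x) = (if a \<in> C then fresh C x else a # fresh (insert a C) x)"

lemma distinct_fresh: "distinct (fresh C x) \<and> set (fresh C x) \<inter> C = {}"
proof (induction x arbitrary: C)
  case (Cons a x)
  show ?case using Cons[of C] Cons[of "insert a C"] by auto
qed simp

text \<open>No agent before the first compatible one has its type, and the types in C are
  incompatible, so what \<open>fresh\<close> drops does not matter. Hence the type that a good takes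
  is a function of the ordering alone.\<close>

lemma find_fresh: "\<forall>c\<in>C. \<not> P c \<Longrightarrow> find P (fresh C x) = find P x"
  by (induction x arbitrary: C) auto

text \<open>Sums over all lists are integrals of extended nonnegative functions, so splitting by the
  head needs no summability; convergence is a result of the computation.\<close>

lemma nn_integral_count_space_list:
  fixes f :: "'a::finite list \<Rightarrow> ennreal"
  shows "(\<integral>\<^sup>+x. f x \<partial>count_space UNIV) = f [] + (\<Sum>a\<in>UNIV. \<integral>\<^sup>+x. f (a # x) \<partial>count_space UNIV)"
proof -
  have split: "f x = f x * indicator {[]} x + (\<Sum>a\<in>UNIV. f x * indicator (range ((#) a)) x)" for x
  proof (cases x)
    case (Cons b y)
    have "(\<Sum>a\<in>UNIV. f x * indicator (range ((#) a)) x) = (\<Sum>a\<in>UNIV. if b = a then f x else 0)"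
      by (intro sum.cong) (auto simp: Cons indicator_def)
    then show ?thesis by (simp add: Cons)
  qed auto
  have cons: "(\<integral>\<^sup>+x. f x * indicator (range ((#) a)) x \<partial>count_space UNIV) =
      (\<integral>\<^sup>+x. f (a # x) \<partial>count_space UNIV)" for a
    by (subst nn_integral_count_space_indicator[symmetric], simp,
        rule nn_integral_bij_count_space[symmetric]) (auto simp: bij_betw_def inj_on_def)
  have "(\<integral>\<^sup>+x. f x \<partial>count_space UNIV) =
      (\<integral>\<^sup>+x. f x * indicator {[]} x \<partial>count_space UNIV) +
      (\<Sum>a\<in>UNIV. \<integral>\<^sup>+x. f x * indicator (range ((#) a)) x \<partial>count_space UNIV)"
    by (subst nn_integral_sum[symmetric], simp, subst nn_integral_add[symmetric], simp, simp,
        rule nn_integral_cong, rule split)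
  then show ?thesis
    by (simp only: cons nn_integral_indicator_singleton) simp
qed

section \<open>List weights and their balance equation\<close>

locale fcfs_queue =
  fixes G :: "('s::finite \<times> 'c::finite) set" and lam :: "'c \<Rightarrow> real" and mu :: "'s \<Rightarrow> real"
    and q :: "('c, 's) item pmf" and r :: real
  assumes r_pos: "r > 0"
    and pmf_agent: "pmf q (Agent c) = lam c / r"
    and pmf_good: "pmf q (Good s) = mu s / r"
    and stable: "stability_condition G lam mu"
begin

lemma lam_nonneg: "0 \<le> lam c"
  using pmf_nonneg[of q "Agent c"] r_pos by (simp add: pmf_agent zero_le_divide_iff)

lemma mu_nonneg: "0 \<le> mu s"
  using pmf_nonneg[of q "Good s"] r_pos by (simp add: pmf_good zero_le_divide_iff)

lemma sum_items:
  fixes g :: "('c, 's) item \<Rightarrow> real"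
  shows "(\<Sum>z\<in>UNIV. g z) = (\<Sum>c\<in>UNIV. g (Agent c)) + (\<Sum>s\<in>UNIV. g (Good s))"
  by (subst UNIV_Plus_UNIV[symmetric], subst sum.Plus) auto

lemma sum_rates: "sum lam UNIV + sum mu UNIV = r"
proof -
  have "1 = (\<Sum>z\<in>UNIV. pmf q z)" by (simp add: sum_pmf_eq_1)
  also have "\<dots> = (sum lam UNIV + sum mu UNIV) / r"
    by (simp add: sum_items pmf_agent pmf_good add_divide_distrib sum_divide_distrib)
  finally show ?thesis using r_pos by (simp add: field_simps)
qed

definition cap :: "'c set \<Rightarrow> real" where
  "cap C = sum mu (goods_of G C)"

lemma cap_gt: "C \<noteq> {} \<Longrightarrow> sum lam C < cap C"
  using stable by (auto simp: stability_condition_def cap_def)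

lemma cap_pos: "C \<noteq> {} \<Longrightarrow> 0 < cap C"
  using cap_gt[of C] sum_nonneg[of C lam] lam_nonneg by fastforce

lemma cap_empty [simp]: "cap {} = 0"
  by (simp add: cap_def goods_of_def)

text \<open>This is the rate of the goods that pass over every type in C and accept a.\<close>

lemma cap_insert_diff: "cap (insert a C) - cap C = (\<Sum>s | s \<notin> goods_of G C \<and> (s, a) \<in> G. mu s)"
proof -
  have "goods_of G (insert a C) = goods_of G C \<union> {s. s \<notin> goods_of G C \<and> (s, a) \<in> G}"
    by (auto simp: goods_of_def)
  then show ?thesis
    unfolding cap_def by (simp add: sum.union_disjoint[OF finite finite] Int_def)
qed

fun step :: "'c list \<Rightarrow> ('c, 's) item \<Rightarrow> 'c list" where
  "step x (Inl c) = x @ [c]"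
| "step x (Inr s) = remove_first (\<lambda>c. (s, c) \<in> G) x"

text \<open>The unnormalised stationary probability of a continuation \<open>x\<close> of a list whose set of types
  is \<open>C\<close>, relative to that list.\<close>

primrec weight :: "'c set \<Rightarrow> 'c list \<Rightarrow> real" where
  "weight C [] = 1"
| "weight C (c # x) = lam c / cap (insert c C) * weight (insert c C) x"

lemma weight_nonneg: "0 \<le> weight C x"
  by (induction x arbitrary: C) (auto intro!: mult_nonneg_nonneg divide_nonneg_pos lam_nonneg cap_pos)

lemma ennreal_weight_Cons:
  "ennreal (weight C (a # x)) = ennreal (lam a / cap (insert a C)) * ennreal (weight (insert a C) x)"
proof -
  have "0 \<le> lam a / cap (insert a C)"
    using lam_nonneg[of a] cap_pos[of "insert a C"] by simp
  then show ?thesis by (simp only: weight.simps(2) ennreal_mult')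
qed

lemma weight_snoc: "weight C (x @ [c]) = weight C x * (lam c / cap (insert c (C \<union> set x)))"
  by (induction x arbitrary: C) (auto simp: insert_commute)

text \<open>Both sides are \<open>lam a * lam b / cap (insert a (insert b C))\<close> times the
  weight of y over the enlarged set. This symmetry between an inserted agent and the head of the
  list carries the induction in the balance equation.\<close>

lemma lam_mult_weight_insert:
  "lam a * weight (insert a C) (b # y) = lam b * weight (insert b C) (a # y)"
  by (simp add: insert_commute)

lemma cap_mult_weight_Cons: "cap (insert a C) * weight C (a # x) = lam a * weight (insert a C) x"
  using cap_pos[of "insert a C"] by simp

text \<open>The total weight of the lists that a good of type s turns into the given one, by
  \<open>nn_integral_removal_weight\<close>. Such a list arises by inserting a compatible agent
  behind a prefix of incompatible ones, or is the given list itself if nothing in it is compatible;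
  the summand 1 stands for the latter.\<close>

primrec removal_weight :: "'s \<Rightarrow> 'c set \<Rightarrow> 'c list \<Rightarrow> real" where
  "removal_weight s C [] = 1 + (\<Sum>a\<in>agents_of G s. weight C [a])"
| "removal_weight s C (b # y) = (\<Sum>a\<in>agents_of G s. weight C (a # b # y)) +
     (if (s, b) \<in> G then 0 else lam b / cap (insert b C) * removal_weight s (insert b C) y)"

lemma removal_weight_nonneg: "0 \<le> removal_weight s C i"
proof (induction i arbitrary: C)
  case Nil
  show ?case unfolding removal_weight.simps by (intro add_nonneg_nonneg sum_nonneg weight_nonneg) simp
next
  case (Cons b y)
  have "0 \<le> lam b / cap (insert b C)"
    using lam_nonneg[of b] cap_pos[of "insert b C"] by simp
  then show ?case
    unfolding removal_weight.simps using Cons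
    by (intro add_nonneg_nonneg sum_nonneg weight_nonneg) (simp only: mult_nonneg_nonneg if_split, simp)
qed

lemma nn_integral_removal_weight:
  "(\<integral>\<^sup>+x. ennreal (weight C x) * indicator {x. step x (Good s) = i} x \<partial>count_space UNIV) =
    ennreal (removal_weight s C i)"
proof (induction i arbitrary: C)
  case Nil
  have "(\<integral>\<^sup>+x. ennreal (weight C (a # x)) * indicator {x. step x (Good s) = []} (a # x) \<partial>count_space UNIV) =
      (if (s, a) \<in> G then ennreal (weight C [a]) else 0)" for a
  proof (cases "(s, a) \<in> G")
    case True
    then have "(\<integral>\<^sup>+x. ennreal (weight C (a # x)) * indicator {x. step x (Good s) = []} (a # x) \<partial>count_space UNIV) =
       (\<integral>\<^sup>+x. ennreal (weight C (a # x)) * indicator {[]} x \<partial>count_space UNIV)"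
      by (intro nn_integral_cong) (auto simp: indicator_def)
    then show ?thesis using True by (simp add: nn_integral_indicator_singleton)
  qed (simp add: indicator_def)
  then show ?case
    by (subst nn_integral_count_space_list)
      (simp add: sum.If_cases agents_of_def weight_nonneg sum_nonneg
        del: weight.simps(2))
next
  case (Cons b y)
  \<comment> \<open>A compatible head a is taken, so the tail must be \<open>b # y\<close>. An
    incompatible head stays, so a = b and the tail is a predecessor of y.\<close>
  have *: "(\<integral>\<^sup>+x. ennreal (weight C (a # x)) * indicator {x. step x (Good s) = b # y} (a # x) \<partial>count_space UNIV) =
      (if (s, a) \<in> G then ennreal (weight C (a # b # y)) else 0) +
      (if a = b then if (s, b) \<in> G then 0 else
        ennreal (lam b / cap (insert b C) * removal_weight s (insert b C) y) else 0)" for a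
  proof (cases "(s, a) \<in> G")
    case True
    then have "(\<integral>\<^sup>+x. ennreal (weight C (a # x)) * indicator {x. step x (Good s) = b # y} (a # x) \<partial>count_space UNIV) =
       (\<integral>\<^sup>+x. ennreal (weight C (a # x)) * indicator {b # y} x \<partial>count_space UNIV)"
      by (intro nn_integral_cong) (auto simp: indicator_def)
    then show ?thesis using True by (auto simp: nn_integral_indicator_singleton simp del: weight.simps)
  next
    case False
    have nn: "0 \<le> lam b / cap (insert b C)" by (intro divide_nonneg_pos lam_nonneg cap_pos) auto
    have "(\<integral>\<^sup>+x. ennreal (weight C (a # x)) * indicator {x. step x (Good s) = b # y} (a # x) \<partial>count_space UNIV) =
       (\<integral>\<^sup>+x. (if a = b then ennreal (lam b / cap (insert b C)) else 0) *
          (ennreal (weight (insert b C) x) * indicator {x. step x (Good s) = y} x) \<partial>count_space UNIV)"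
      using False
      by (intro nn_integral_cong) (auto simp: indicator_def ennreal_weight_Cons simp del: weight.simps(2))
    also have "\<dots> = (if a = b then ennreal (lam b / cap (insert b C)) else 0) *
        ennreal (removal_weight s (insert b C) y)"
      by (simp only: nn_integral_cmult[OF borel_measurable_count_space] Cons.IH)
    finally show ?thesis
      using False ennreal_mult'[OF nn, of "removal_weight s (insert b C) y"] by auto
  qed
  define k where "k = (if (s, b) \<in> G then 0 else lam b / cap (insert b C) * removal_weight s (insert b C) y)"
  have k: "0 \<le> k"
    unfolding k_def
    by (auto intro!: mult_nonneg_nonneg divide_nonneg_pos lam_nonneg cap_pos removal_weight_nonneg)
  have "(if (s, b) \<in> G then 0 else
        ennreal (lam b / cap (insert b C) * removal_weight s (insert b C) y)) = ennreal k"
    by (simp add: k_def)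
  note * = *[unfolded this]
  have "(\<integral>\<^sup>+x. ennreal (weight C x) * indicator {x. step x (Good s) = b # y} x \<partial>count_space UNIV) =
      (\<Sum>a\<in>agents_of G s. ennreal (weight C (a # b # y))) + ennreal k"
    by (subst nn_integral_count_space_list, subst *)
      (simp add: sum.distrib sum.If_cases agents_of_def del: weight.simps)
  also have "\<dots> = ennreal ((\<Sum>a\<in>agents_of G s. weight C (a # b # y)) + k)"
    using k by (subst sum_ennreal) (auto intro!: ennreal_plus[symmetric] sum_nonneg weight_nonneg simp del: weight.simps)
  finally show ?case by (simp only: k_def removal_weight.simps)
qed

text \<open>Without the last term the balance equation below would not be closed under the
  recursion on \<open>x\<close>; that term vanishes for \<open>C = {}\<close>.\<close>

lemma removal_weight_balance:
  "(\<Sum>s\<in>- goods_of G C. mu s * removal_weight s C x) =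
    (sum mu UNIV - cap (C \<union> set x)) * weight C x + sum lam UNIV * weight C x -
    cap C * (\<Sum>a\<in>UNIV. weight C (a # x))"
proof (induction x arbitrary: C)
  \<comment> \<open>After exchanging the sums, the goods that pass over C and accept a add up to an
    increment of \<open>cap\<close>.\<close>
  have swap: "(\<Sum>s\<in>- goods_of G C. mu s * (\<Sum>a\<in>agents_of G s. w a)) =
      (\<Sum>a\<in>UNIV. (cap (insert a C) - cap C) * w a)" for C and w :: "'c \<Rightarrow> real"
  proof -
    have "(\<Sum>s\<in>- goods_of G C. mu s * (\<Sum>a\<in>agents_of G s. w a)) =
        (\<Sum>s\<in>- goods_of G C. \<Sum>a\<in>UNIV. if (s, a) \<in> G then mu s * w a else 0)"
      by (simp add: sum_distrib_left agents_of_def sum.If_cases)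
    also have "\<dots> = (\<Sum>a\<in>UNIV. \<Sum>s\<in>- goods_of G C. if (s, a) \<in> G then mu s * w a else 0)"
      by (rule sum.swap)
    also have "\<dots> = (\<Sum>a\<in>UNIV. (cap (insert a C) - cap C) * w a)"
      by (simp add: cap_insert_diff sum_distrib_right sum.If_cases Int_def)
    finally show ?thesis .
  qed
  {
    case Nil
    have "(\<Sum>s\<in>- goods_of G C. mu s * removal_weight s C []) =
      (\<Sum>s\<in>- goods_of G C. mu s) + (\<Sum>a\<in>UNIV. (cap (insert a C) - cap C) * weight C [a])"
      by (simp add: distrib_left sum.distrib swap)
    also have "(\<Sum>s\<in>- goods_of G C. mu s) = sum mu UNIV - cap C"
      by (simp add: cap_def Compl_eq_Diff_UNIV sum_diff)
    also have "(\<Sum>a\<in>UNIV. (cap (insert a C) - cap C) * weight C [a]) =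
        sum lam UNIV - cap C * (\<Sum>a\<in>UNIV. weight C [a])"
      by (simp add: left_diff_distrib cap_mult_weight_Cons sum_subtractf sum_distrib_left del: weight.simps(2))
    finally show ?case by simp
  next
    case (Cons b y)
    have compl: "- goods_of G C \<inter> {s. (s, b) \<notin> G} = - goods_of G (insert b C)"
      by (auto simp: goods_of_def)
    let ?k = "lam b / cap (insert b C)"
    have "(\<Sum>s\<in>- goods_of G C. mu s * removal_weight s C (b # y)) =
        (\<Sum>a\<in>UNIV. (cap (insert a C) - cap C) * weight C (a # b # y)) +
        (\<Sum>s\<in>- goods_of G C. if (s, b) \<notin> G then ?k * (mu s * removal_weight s (insert b C) y) else 0)"
      by (simp add: distrib_left sum.distrib swap del: weight.simps) (intro sum.cong; simp)
    also have "(\<Sum>s\<in>- goods_of G C. if (s, b) \<notin> G then ?k * (mu s * removal_weight s (insert b C) y) else 0) =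
        ?k * (\<Sum>s\<in>- goods_of G (insert b C). mu s * removal_weight s (insert b C) y)"
      by (subst sum.If_cases) (auto simp: compl sum_distrib_left)
    \<comment> \<open>The last term of the induction hypothesis carries the factor
      \<open>cap (insert b C)\<close>, which cancels the denominator of \<open>?k\<close>.\<close>
    also have "\<dots> = (sum mu UNIV - cap (C \<union> set (b # y))) * weight C (b # y) +
        sum lam UNIV * weight C (b # y) - lam b * (\<Sum>a\<in>UNIV. weight (insert b C) (a # y))"
      using cap_pos[of "insert b C"] unfolding Cons.IH
      by (simp add: field_simps del: weight.simps(2)) (simp add: field_simps)
    also have "(\<Sum>a\<in>UNIV. (cap (insert a C) - cap C) * weight C (a # b # y)) =
        (\<Sum>a\<in>UNIV. lam a * weight (insert a C) (b # y)) - cap C * (\<Sum>a\<in>UNIV. weight C (a # b # y))"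
      by (simp add: left_diff_distrib cap_mult_weight_Cons sum_subtractf sum_distrib_left del: weight.simps(2))
    \<comment> \<open>After the exchange of a and b this sum cancels the negative term left by the
      induction hypothesis.\<close>
    also have "(\<Sum>a\<in>UNIV. lam a * weight (insert a C) (b # y)) =
        lam b * (\<Sum>a\<in>UNIV. weight (insert b C) (a # y))"
      by (simp add: lam_mult_weight_insert sum_distrib_left del: weight.simps)
    finally show ?case by simp
  }
qed

section \<open>Summation over repetitions of types already seen\<close>

lemma nn_integral_weight_split:
  "(\<integral>\<^sup>+x. ennreal (weight C x) * f x \<partial>count_space UNIV) = f [] +
    (\<Sum>a\<in>UNIV. ennreal (lam a / cap (insert a C)) *
      (\<integral>\<^sup>+x. ennreal (weight (insert a C) x) * f (a # x) \<partial>count_space UNIV))"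
proof -
  have "(\<integral>\<^sup>+x. ennreal (weight C (a # x)) * f (a # x) \<partial>count_space UNIV) =
      (\<integral>\<^sup>+x. ennreal (lam a / cap (insert a C)) * (ennreal (weight (insert a C) x) * f (a # x)) \<partial>count_space UNIV)" for a
    by (simp only: ennreal_weight_Cons mult.assoc)
  then show ?thesis
    by (subst nn_integral_count_space_list) (simp add: nn_integral_cmult del: weight.simps(2))
qed

text \<open>The ratio of the geometric series: with type set C, one further agent of a type c in C
  multiplies the weight by \<open>lam c / cap C\<close>. For C = {} the value is 0.\<close>

definition load :: "'c set \<Rightarrow> real" where
  "load C = sum lam C / cap C"

lemma load_bounds: "0 \<le> load C" "load C < 1"
proof -
  show "0 \<le> load C"
    unfolding load_def cap_def by (intro divide_nonneg_nonneg sum_nonneg lam_nonneg mu_nonneg)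
  show "load C < 1"
    using cap_gt[of C] cap_pos[of C] by (cases "C = {}") (auto simp: load_def)
qed

text \<open>The unnormalised \<open>pi_Y\<close>, relative to types C already present. Lists that
  repeat a type or meet C get 0, so that the formula for integrals over \<open>fresh\<close> holds
  for all \<open>Cs\<close>.\<close>

primrec order_weight :: "'c set \<Rightarrow> 'c list \<Rightarrow> real" where
  "order_weight C [] = 1"
| "order_weight C (c # Cs) = (if c \<in> C then 0 else
     lam c / (cap (insert c C) - sum lam (insert c C)) * order_weight (insert c C) Cs)"

lemma order_weight_nonneg: "0 \<le> order_weight C Cs"
proof (induction Cs arbitrary: C)
  case (Cons c Cs)
  then show ?case
    using cap_gt[of "insert c C"]
    by (simp add: lam_nonneg divide_nonneg_pos mult_nonneg_nonneg del: sum.insert_if sum.insert)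
qed simp

text \<open>The factor \<open>1 / (1 - load (insert c C))\<close> sums the repetitions between the
  first c and the next new type.\<close>

lemma order_weight_step:
  assumes "c \<notin> C"
  shows "order_weight C (c # Cs) =
    lam c / cap (insert c C) * (order_weight (insert c C) Cs / (1 - load (insert c C)))"
proof -
  have "cap (insert c C) * (1 - load (insert c C)) = cap (insert c C) - sum lam (insert c C)"
    using cap_pos[of "insert c C"] unfolding load_def right_diff_distrib by (simp del: sum.insert_if sum.insert)
  then have "order_weight C (c # Cs) =
      lam c / (cap (insert c C) * (1 - load (insert c C))) * order_weight (insert c C) Cs"
    using assms by (simp only: order_weight.simps if_False)
  then show ?thesis by (simp only: times_divide_eq_left times_divide_eq_right divide_divide_eq_left mult.commute)
qed

lemma order_weight_eq_ordering_weight: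
  assumes "distinct Cs"
  shows "order_weight {} Cs = ordering_weight G lam mu Cs"
proof -
  have "order_weight C Cs = (\<Prod>l<length Cs. lam (Cs ! l) /
      (cap (C \<union> set (take (Suc l) Cs)) - sum lam (C \<union> set (take (Suc l) Cs))))"
    if "set Cs \<inter> C = {}" for C
    using that assms
  proof (induction Cs arbitrary: C)
    case (Cons c Cs)
    then have "order_weight (insert c C) Cs = (\<Prod>l<length Cs. lam (Cs ! l) /
        (cap (insert c C \<union> set (take (Suc l) Cs)) - sum lam (insert c C \<union> set (take (Suc l) Cs))))"
      by (intro Cons.IH) auto
    then show ?case
      using Cons.prems by (simp add: prod.lessThan_Suc_shift del: prod.lessThan_Suc)
  qed simp
  from this[of "{}"] show ?thesis
    by (simp add: ordering_weight_def cap_def)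
qed

text \<open>Solving the recursion for the second integral sums the geometric series over repetitions of
  the types in \<open>C\<close>. The truncated integrals show that this integral is finite.\<close>

lemma fresh_recursion:
  fixes C Cs
  defines "extend \<equiv> \<lambda>h :: 'c set \<Rightarrow> 'c list \<Rightarrow> ennreal. indicator {[]} Cs + ennreal (load C) * h C Cs +
      (case Cs of [] \<Rightarrow> 0 | c # Cs' \<Rightarrow>
        if c \<in> C then 0 else ennreal (lam c / cap (insert c C)) * h (insert c C) Cs')"
  shows "(\<integral>\<^sup>+x. ennreal (weight C x) * (indicator {x. fresh C x = Cs} x * indicator {x. length x < Suc n} x) \<partial>count_space UNIV) =
      extend (\<lambda>C Cs. \<integral>\<^sup>+x. ennreal (weight C x) * (indicator {x. fresh C x = Cs} x * indicator {x. length x < n} x) \<partial>count_space UNIV)" (is ?A)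
    and "(\<integral>\<^sup>+x. ennreal (weight C x) * indicator {x. fresh C x = Cs} x \<partial>count_space UNIV) =
      extend (\<lambda>C Cs. \<integral>\<^sup>+x. ennreal (weight C x) * indicator {x. fresh C x = Cs} x \<partial>count_space UNIV)" (is ?B)
proof -
  \<comment> \<open>The pair \<open>b\<close>, \<open>b'\<close> serves both claims: a length bound
    and the corresponding bound for the tail, or the constant 1 twice.\<close>
  have *: "(\<integral>\<^sup>+x. ennreal (weight C x) * (indicator {x. fresh C x = Cs} x * b x) \<partial>count_space UNIV) =
      extend (\<lambda>C Cs. \<integral>\<^sup>+x. ennreal (weight C x) * (indicator {x. fresh C x = Cs} x * b' x) \<partial>count_space UNIV)"
    if b: "b [] = 1" "\<And>a x. b (a # x) = b' x" for b b' :: "'c list \<Rightarrow> ennreal"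
  proof -
    let ?I = "\<lambda>C Cs. \<integral>\<^sup>+x. ennreal (weight C x) * (indicator {x. fresh C x = Cs} x * b' x) \<partial>count_space UNIV"
    have I: "(\<integral>\<^sup>+x. ennreal (weight (insert a C) x) *
          (indicator {x. fresh C x = Cs} (a # x) * b (a # x)) \<partial>count_space UNIV) =
        (if a \<in> C then ?I C Cs else 0) +
        (case Cs of [] \<Rightarrow> 0 | c # Cs' \<Rightarrow> if a = c then if c \<in> C then 0 else ?I (insert c C) Cs' else 0)" for a
    proof (cases "a \<in> C")
      case True
      then show ?thesis by (auto simp: b insert_absorb indicator_def split: list.splits)
    next
      case False
      then show ?thesis by (auto simp: b indicator_def split: list.splits)
    qed
    have "(\<Sum>a\<in>UNIV. ennreal (lam a / cap (insert a C)) * (if a \<in> C then ?I C Cs else 0)) =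
        (\<Sum>a\<in>C. ennreal (lam a / cap C)) * ?I C Cs"
      by (simp add: sum_distrib_right if_distrib[of "(*) _"] sum.If_cases insert_absorb)
    also have "(\<Sum>a\<in>C. ennreal (lam a / cap C)) = ennreal (load C)"
      unfolding load_def sum_divide_distrib
      by (intro sum_ennreal) (auto simp: cap_def intro!: divide_nonneg_nonneg lam_nonneg sum_nonneg mu_nonneg)
    finally have 1: "(\<Sum>a\<in>UNIV. ennreal (lam a / cap (insert a C)) * (if a \<in> C then ?I C Cs else 0)) =
        ennreal (load C) * ?I C Cs" .
    have 2: "(\<Sum>a\<in>UNIV. ennreal (lam a / cap (insert a C)) *
          (case Cs of [] \<Rightarrow> 0 | c # Cs' \<Rightarrow> if a = c then if c \<in> C then 0 else ?I (insert c C) Cs' else 0)) =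
        (case Cs of [] \<Rightarrow> 0 | c # Cs' \<Rightarrow>
          if c \<in> C then 0 else ennreal (lam c / cap (insert c C)) * ?I (insert c C) Cs')"
      by (auto simp: mult_delta_right split: list.splits)
    have 3: "indicator {x. fresh C x = Cs} [] * b [] = (indicator {[]} Cs :: ennreal)"
      by (auto simp: b indicator_def)
    show ?thesis
      unfolding extend_def
      by (subst nn_integral_weight_split) (simp only: I 3 distrib_left sum.distrib 1 2 add.assoc)
  qed
  show ?A by (rule *) (auto simp: indicator_def)
  show ?B using *[of "\<lambda>_. 1" "\<lambda>_. 1"] by simp
qed

lemma nn_integral_fresh:
  "(\<integral>\<^sup>+x. ennreal (weight C x) * indicator {x. fresh C x = Cs} x \<partial>count_space UNIV) =
    ennreal (order_weight C Cs / (1 - load C))" (is "?I C Cs = ennreal (?B C Cs)")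
proof -
  have B_nonneg: "0 \<le> ?B C Cs" for C Cs
    using load_bounds[of C] order_weight_nonneg[of C Cs] by simp
  have k_nonneg: "0 \<le> lam c / cap (insert c C)" for c C
    using lam_nonneg[of c] cap_pos[of "insert c C"] by simp
  have head: "indicator {[]} Cs + (case Cs of [] \<Rightarrow> 0 | c # Cs' \<Rightarrow>
        if c \<in> C then 0 else ennreal (lam c / cap (insert c C)) * ennreal (?B (insert c C) Cs')) =
      ennreal (order_weight C Cs)" for C Cs
  proof (cases Cs)
    case (Cons c Cs')
    show ?thesis
    proof (cases "c \<in> C")
      case False
      then show ?thesis
        unfolding Cons order_weight_step[OF False] ennreal_mult'[OF k_nonneg] by simp
    qed (simp add: Cons)
  qed simp
  have B_rec: "indicator {[]} Cs + ennreal (load C) * ennreal (?B C Cs) +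
      (case Cs of [] \<Rightarrow> 0 | c # Cs' \<Rightarrow>
        if c \<in> C then 0 else ennreal (lam c / cap (insert c C)) * ennreal (?B (insert c C) Cs')) =
      ennreal (?B C Cs)" for C Cs
  proof -
    have "indicator {[]} Cs + ennreal (load C) * ennreal (?B C Cs) +
      (case Cs of [] \<Rightarrow> 0 | c # Cs' \<Rightarrow>
        if c \<in> C then 0 else ennreal (lam c / cap (insert c C)) * ennreal (?B (insert c C) Cs')) =
      ennreal (order_weight C Cs) + ennreal (load C) * ennreal (?B C Cs)"
      unfolding head[symmetric] by (simp add: ac_simps)
    also have "\<dots> = ennreal (order_weight C Cs + load C * ?B C Cs)"
      using load_bounds[of C] B_nonneg[of C Cs]
      by (simp only: ennreal_mult'[symmetric] ennreal_plus order_weight_nonneg mult_nonneg_nonneg)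
    also have "order_weight C Cs + load C * ?B C Cs = ?B C Cs"
      using load_bounds[of C] by (simp add: field_simps)
    finally show ?thesis .
  qed
  \<comment> \<open>The claimed value is a fixed point of a monotone recursion
    (\<open>B_rec\<close>), which the truncated integrals iterate from 0; so they stay below
    it.\<close>
  have trunc: "(\<integral>\<^sup>+x. ennreal (weight C x) * (indicator {x. fresh C x = Cs} x * indicator {x. length x < n} x) \<partial>count_space UNIV)
      \<le> ennreal (?B C Cs)" for n C Cs
  proof (induction n arbitrary: C Cs)
    case (Suc n)
    show ?case
      unfolding fresh_recursion(1)
      by (subst B_rec[symmetric], intro add_mono order_refl mult_left_mono Suc)
        (auto split: list.splits intro!: mult_left_mono Suc)
  qed simp
  have le: "?I C Cs \<le> ennreal (?B C Cs)" for C Cs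
  proof -
    have "?I C Cs = (\<integral>\<^sup>+x. (SUP n. ennreal (weight C x) * (indicator {x. fresh C x = Cs} x * indicator {x. length x < n} x)) \<partial>count_space UNIV)"
    proof (intro nn_integral_cong antisym SUP_least)
      fix x
      show "ennreal (weight C x) * indicator {x. fresh C x = Cs} x \<le>
        (SUP n. ennreal (weight C x) * (indicator {x. fresh C x = Cs} x * indicator {x. length x < n} x))"
        by (rule SUP_upper2[of "Suc (length x)"]) auto
    qed (auto simp: indicator_def)
    also have "\<dots> = (SUP n. \<integral>\<^sup>+x. ennreal (weight C x) * (indicator {x. fresh C x = Cs} x * indicator {x. length x < n} x) \<partial>count_space UNIV)"
      by (intro nn_integral_monotone_convergence_SUP)
        (auto simp: mono_def le_fun_def indicator_def incseq_def)
    also have "\<dots> \<le> ennreal (?B C Cs)"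
      by (intro SUP_least trunc)
    finally show ?thesis .
  qed
  \<comment> \<open>For positive load, infinity also solves the linear equation; \<open>le\<close>
    excludes it.\<close>
  have solve: "?I C Cs = ennreal (?B C Cs)"
    if "indicator {[]} Cs + (case Cs of [] \<Rightarrow> 0 | c # Cs' \<Rightarrow>
        if c \<in> C then 0 else ennreal (lam c / cap (insert c C)) * ?I (insert c C) Cs') =
      ennreal (order_weight C Cs)" for C Cs
  proof -
    obtain i where i: "?I C Cs = ennreal i" "0 \<le> i"
      using le[of C Cs] by (cases "?I C Cs") (auto simp: top_unique)
    have "?I C Cs = ennreal (order_weight C Cs) + ennreal (load C) * ?I C Cs"
      by (subst fresh_recursion(2), subst that[symmetric]) (simp add: ac_simps)
    then have "ennreal i = ennreal (order_weight C Cs + load C * i)"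
      using load_bounds[of C] i by (simp add: ennreal_mult' ennreal_plus order_weight_nonneg)
    then have "i = order_weight C Cs + load C * i"
      using load_bounds[of C] i by (subst (asm) ennreal_inj) (auto simp: order_weight_nonneg)
    then have "i = ?B C Cs"
      using load_bounds[of C] by (simp add: field_simps)
    then show ?thesis by (simp add: i)
  qed
  show ?thesis
  proof (induction Cs arbitrary: C)
    case Nil
    show ?case using head[of "[]" C] by (intro solve) simp
  next
    case (Cons c Cs)
    show ?case
      by (rule solve, subst head[symmetric]) (simp add: Cons)
  qed
qed

end

section \<open>The stationary distribution and bounds on emptying times\<close>

context fcfs_queue
begin

lemma finite_distinct_lists: "finite {Cs :: 'c list. distinct Cs}"
  by (rule finite_subset[OF _ finite_lists_length_le[of "UNIV :: 'c set" "CARD('c)"]])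
    (auto simp: card_mono simp flip: distinct_card)

definition total_weight :: real where
  "total_weight = (\<Sum>Cs | distinct Cs. order_weight {} Cs)"

lemma total_weight_pos: "0 < total_weight"
proof -
  have "order_weight {} [] \<le> total_weight"
    unfolding total_weight_def using finite_distinct_lists order_weight_nonneg
    by (intro member_le_sum) auto
  then show ?thesis by simp
qed

lemma nn_integral_weight: "(\<integral>\<^sup>+x. ennreal (weight {} x) \<partial>count_space UNIV) = ennreal total_weight"
proof -
  have "ennreal (weight {} x) = (\<Sum>Cs | distinct Cs. ennreal (weight {} x) * indicator {x. fresh {} x = Cs} x)" for x
  proof -
    have "(\<Sum>Cs | distinct Cs. ennreal (weight {} x) * indicator {x. fresh {} x = Cs} x) =
        (\<Sum>Cs | distinct Cs. if fresh {} x = Cs then ennreal (weight {} x) else 0)"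
      by (intro sum.cong) (auto simp: indicator_def)
    also have "\<dots> = ennreal (weight {} x)"
      using finite_distinct_lists distinct_fresh[of "{}" x] by (subst sum.delta') auto
    finally show ?thesis by simp
  qed
  then have "(\<integral>\<^sup>+x. ennreal (weight {} x) \<partial>count_space UNIV) =
      (\<Sum>Cs | distinct Cs. \<integral>\<^sup>+x. ennreal (weight {} x) * indicator {x. fresh {} x = Cs} x \<partial>count_space UNIV)"
    by (subst nn_integral_sum[symmetric]) (auto intro!: nn_integral_cong)
  also have "\<dots> = ennreal total_weight"
    unfolding total_weight_def nn_integral_fresh load_def
    by (simp add: sum_ennreal order_weight_nonneg)
  finally show ?thesis .
qed

definition stationary :: "'c list pmf" where
  "stationary = embed_pmf (\<lambda>x. weight {} x / total_weight)"

lemma pmf_stationary: "pmf stationary x = weight {} x / total_weight"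
  unfolding stationary_def
proof (rule pmf_embed_pmf)
  show "0 \<le> weight {} x / total_weight" for x
    using weight_nonneg[of "{}" x] total_weight_pos by simp
  have "(\<integral>\<^sup>+x. ennreal (weight {} x / total_weight) \<partial>count_space UNIV) =
      (\<integral>\<^sup>+x. ennreal (weight {} x) / ennreal total_weight \<partial>count_space UNIV)"
    using weight_nonneg total_weight_pos by (intro nn_integral_cong) (simp add: divide_ennreal)
  also have "\<dots> = 1"
    using total_weight_pos by (subst nn_integral_divide) (auto simp: nn_integral_weight divide_ennreal)
  finally show "(\<integral>\<^sup>+x. ennreal (weight {} x / total_weight) \<partial>count_space UNIV) = 1" .
qed

lemma measure_stationary:
  assumes "(\<integral>\<^sup>+x. ennreal (weight {} x) * indicator E x \<partial>count_space UNIV) = ennreal v" "0 \<le> v"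
  shows "measure stationary E = v / total_weight"
proof -
  have "ennreal (measure stationary E) = (\<integral>\<^sup>+x. indicator E x \<partial>measure_pmf stationary)"
    by (simp add: measure_pmf.emeasure_eq_measure)
  also have "\<dots> = (\<integral>\<^sup>+x. ennreal (weight {} x / total_weight) * indicator E x \<partial>count_space UNIV)"
    by (simp only: nn_integral_measure_pmf pmf_stationary)
  also have "\<dots> = (\<integral>\<^sup>+x. (ennreal (weight {} x) * indicator E x) / ennreal total_weight \<partial>count_space UNIV)"
    using weight_nonneg total_weight_pos
    by (intro nn_integral_cong) (auto simp: divide_ennreal indicator_def)
  also have "\<dots> = ennreal (v / total_weight)"
    using total_weight_pos assms by (subst nn_integral_divide) (auto simp: divide_ennreal)
  finally show ?thesis using assms(2) total_weight_pos by simp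
qed

lemma measure_stationary_agent:
  "measure stationary {x. step x (Agent c) = i} =
    (if i \<noteq> [] \<and> last i = c then pmf stationary (butlast i) else 0)"
proof (cases "i \<noteq> [] \<and> last i = c")
  case True
  then have "{x. step x (Agent c) = i} = {butlast i}"
    by auto (metis butlast_snoc)
  then show ?thesis using True by (simp add: measure_pmf_single)
next
  case False
  then have "{x. step x (Agent c) = i} = {}" by auto
  then show ?thesis using False by (auto simp del: step.simps)
qed

lemma measure_stationary_good:
  "measure stationary {x. step x (Good s) = i} = removal_weight s {} i / total_weight"
  by (rule measure_stationary[OF nn_integral_removal_weight removal_weight_nonneg])

text \<open>In units of the weight of i, arrivals lead into i at rate \<open>cap (set i)\<close>,
  the rate at which goods remove an agent from i. By the balance equation with C = {} goods lead
  into i at the remaining rate \<open>r - cap (set i)\<close>, lost goods included. The sum is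
  r.\<close>

lemma stationary_invariant: "bind_pmf stationary (\<lambda>x. map_pmf (step x) q) = stationary"
proof (rule pmf_eqI)
  fix i
  have "bind_pmf stationary (\<lambda>x. map_pmf (step x) q) =
      bind_pmf q (\<lambda>z. map_pmf (\<lambda>x. step x z) stationary)"
    unfolding map_pmf_def by (rule bind_commute_pmf)
  then have "pmf (bind_pmf stationary (\<lambda>x. map_pmf (step x) q)) i =
      (\<Sum>z\<in>UNIV. pmf q z * measure stationary {x. step x z = i})"
    by (simp add: pmf_bind integral_measure_pmf[of UNIV] pmf_map vimage_def)
  also have "\<dots> = (\<Sum>c\<in>UNIV. lam c / r * (if i \<noteq> [] \<and> last i = c then pmf stationary (butlast i) else 0)) +
      (\<Sum>s\<in>UNIV. mu s / r * (removal_weight s {} i / total_weight))"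
    by (simp only: sum_items measure_stationary_agent measure_stationary_good pmf_agent pmf_good)
  \<comment> \<open>The factor \<open>cap (set i)\<close> undoes the last denominator of the weight;
    for i = [] both sides are 0 since \<open>cap {} = 0\<close>.\<close>
  also have "(\<Sum>c\<in>UNIV. lam c / r * (if i \<noteq> [] \<and> last i = c then pmf stationary (butlast i) else 0)) =
      cap (set i) * weight {} i / (r * total_weight)"
  proof (cases i rule: rev_cases)
    case (snoc y c)
    have "cap (set (y @ [c])) > 0" by (rule cap_pos) simp
    then show ?thesis
      by (simp add: snoc weight_snoc pmf_stationary mult_delta_right)
  qed simp
  also have "(\<Sum>s\<in>UNIV. mu s / r * (removal_weight s {} i / total_weight)) =
      (\<Sum>s\<in>UNIV. mu s * removal_weight s {} i) / (r * total_weight)"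
    by (simp add: sum_divide_distrib)
  also have "(\<Sum>s\<in>UNIV. mu s * removal_weight s {} i) = r * weight {} i - cap (set i) * weight {} i"
    using removal_weight_balance[of "{}" i]
    by (simp add: goods_of_def sum_rates[symmetric] distrib_right left_diff_distrib)
  also have "cap (set i) * weight {} i / (r * total_weight) +
      (r * weight {} i - cap (set i) * weight {} i) / (r * total_weight) = pmf stationary i"
    using r_pos by (simp add: pmf_stationary add_divide_distrib[symmetric])
  finally show "pmf (bind_pmf stationary (\<lambda>x. map_pmf (step x) q)) i = pmf stationary i" .
qed

lemma measure_stationary_fresh:
  "measure stationary {x. Q (fresh {} x)} =
    (\<Sum>Cs | distinct Cs. order_weight {} Cs / total_weight * of_bool (Q Cs))"
proof -
  have "measure stationary {x. fresh {} x = Cs} = order_weight {} Cs / total_weight" for Cs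
    using nn_integral_fresh[of "{}" Cs] order_weight_nonneg[of "{}" Cs]
    by (intro measure_stationary) (simp_all add: load_def)
  then have eq: "pmf (map_pmf (fresh {}) stationary) Cs = order_weight {} Cs / total_weight" for Cs
    by (simp add: pmf_map vimage_def)
  have "measure stationary {x. Q (fresh {} x)} = measure (map_pmf (fresh {}) stationary) {Cs. Q Cs}"
    by (simp add: vimage_def)
  also have "\<dots> = measure (map_pmf (fresh {}) stationary) {Cs. distinct Cs \<and> Q Cs}"
    using distinct_fresh by (intro measure_pmf.finite_measure_eq_AE) (auto simp: AE_measure_pmf_iff)
  also have "\<dots> = (\<Sum>Cs | distinct Cs \<and> Q Cs. order_weight {} Cs / total_weight)"
    using finite_distinct_lists by (subst measure_measure_pmf_finite) (auto simp: eq)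
  also have "\<dots> = (\<Sum>Cs | distinct Cs. order_weight {} Cs / total_weight * of_bool (Q Cs))"
    using finite_distinct_lists by (intro sum.mono_neutral_cong_left) auto
  finally show ?thesis .
qed

lemma sum_distinct_lists:
  fixes g :: "'c list \<Rightarrow> real"
  shows "(\<Sum>Cs | distinct Cs. g Cs) = (\<Sum>C\<in>UNIV. \<Sum>Cs\<in>permutations_of_set C. g Cs)"
proof -
  have "(\<Sum>C\<in>UNIV. \<Sum>Cs\<in>permutations_of_set C. g Cs) =
      sum g (\<Union>C\<in>UNIV. permutations_of_set C)"
    by (rule sum.UNION_disjoint[symmetric]) (auto simp: permutations_of_set_def intro: finite_subset[OF _ finite_distinct_lists])
  also have "(\<Union>C\<in>UNIV. permutations_of_set C) = {Cs :: 'c list. distinct Cs}"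
    by (auto simp: permutations_of_set_def)
  finally show ?thesis by simp
qed

lemma pi_Y_eq:
  assumes "distinct Cs"
  shows "pi_Y G lam mu Cs = order_weight {} Cs / total_weight"
proof -
  have "(\<Sum>C\<in>UNIV. \<Sum>Cs\<in>permutations_of_set C. ordering_weight G lam mu Cs) = total_weight"
    unfolding total_weight_def sum_distinct_lists
    by (intro sum.cong refl) (auto simp: permutations_of_set_def order_weight_eq_ordering_weight)
  then show ?thesis
    using assms by (simp add: pi_Y_def norm_const_def order_weight_eq_ordering_weight)
qed

text \<open>The lower limit m becomes 1 for matched goods, which need a nonempty list, and 0 for
  lost ones.\<close>

lemma measure_stationary_eq_sum_pi_Y:
  assumes "\<And>Cs. Q Cs \<Longrightarrow> m \<le> length Cs"
  shows "measure stationary {x. Q (fresh {} x)} =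
    (\<Sum>k = m..CARD('c). \<Sum>C | card C = k. \<Sum>Cs\<in>permutations_of_set C.
      pi_Y G lam mu Cs * of_bool (Q Cs))"
proof -
  let ?g = "\<lambda>C. \<Sum>Cs\<in>permutations_of_set C. pi_Y G lam mu Cs * of_bool (Q Cs)"
  have "measure stationary {x. Q (fresh {} x)} = (\<Sum>Cs | distinct Cs. pi_Y G lam mu Cs * of_bool (Q Cs))"
    unfolding measure_stationary_fresh by (intro sum.cong refl) (simp add: pi_Y_eq)
  also have "\<dots> = (\<Sum>C\<in>UNIV. ?g C)"
    by (rule sum_distinct_lists)
  also have "\<dots> = (\<Sum>C | m \<le> card C. ?g C)"
  proof (rule sum.mono_neutral_right)
    show "\<forall>C\<in>UNIV - {C. m \<le> card C}. ?g C = 0"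
    proof
      fix C assume C: "C \<in> UNIV - {C :: 'c set. m \<le> card C}"
      have "\<not> Q Cs" if "Cs \<in> permutations_of_set C" for Cs
        using C assms[of Cs] length_finite_permutations_of_set[OF that] by auto
      then show "?g C = 0" by (intro sum.neutral) auto
    qed
  qed auto
  also have "{C :: 'c set. m \<le> card C} = (\<Union>k\<in>{m..CARD('c)}. {C. card C = k})"
    using card_mono[OF finite subset_UNIV] by auto
  also have "(\<Sum>C\<in>\<dots>. ?g C) = (\<Sum>k = m..CARD('c). \<Sum>C | card C = k. ?g C)"
    by (rule sum.UNION_disjoint) auto
  finally show ?thesis .
qed

section \<open>Emptying times of lists that differ by one agent\<close>

sublocale stationary_chain q step stationary "[]"
  using stationary_invariant total_weight_pos
  by unfold_locales (auto simp: pmf_stationary)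

text \<open>Feed the same items to both lists: they differ by at most one agent until the shorter is
  empty, and then at most a singleton is left, which costs at most L. The set D contains the extra
  agent and all agents behind it. It allows a first use with arriving types only, when L is known
  just for these.\<close>

lemma hit_time_insert:
  assumes D: "\<And>c. lam c \<noteq> 0 \<Longrightarrow> c \<in> D" and L: "\<And>d n. d \<in> D \<Longrightarrow> hit_time n [d] \<le> L"
    and "set (d # b) \<subseteq> D"
  shows "hit_time n (a @ b) \<le> hit_time n (a @ d # b) \<and> hit_time n (a @ d # b) \<le> hit_time n (a @ b) + L"
  using \<open>set (d # b) \<subseteq> D\<close>
proof (induction n arbitrary: a d b)
  case 0
  then show ?case using L[of d 0] by auto
next
  case (Suc n)
  show ?case
  proof (cases "a @ b = []")
    case True
    then have ab: "a = []" "b = []" by auto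
    have "0 \<le> hit_time (Suc n) [d]" by (rule cost_nonneg) auto
    then show ?thesis unfolding ab using L[of d "Suc n"] Suc.prems by (simp del: cost.simps(2))
  next
    case False
    have L0: "0 \<le> L" using L[of d 0] Suc.prems by simp
    \<comment> \<open>The bounds are multiplied by \<open>pmf q z\<close> because an arrival outside
      D, which the induction hypothesis does not cover, has probability 0.\<close>
    have le: "pmf q z * hit_time n (step (a @ b) z) \<le> pmf q z * hit_time n (step (a @ d # b) z) \<and>
        pmf q z * hit_time n (step (a @ d # b) z) \<le> pmf q z * (hit_time n (step (a @ b) z) + L)" for z
    proof (cases z)
      case (Inl c)
      show ?thesis
      proof (cases "lam c = 0")
        case True
        then show ?thesis by (simp add: Inl pmf_agent)
      next
        case False
        then have "set (d # b @ [c]) \<subseteq> D" using D Suc.prems by auto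
        from Suc.IH[OF this, of a] show ?thesis
          by (auto simp: Inl intro!: mult_left_mono)
      qed
    next
      case (Inr s)
      show ?thesis
        using remove_first_insert[of "\<lambda>c. (s, c) \<in> G" a d b]
      proof (elim disjE exE conjE)
        assume "remove_first (\<lambda>c. (s, c) \<in> G) (a @ d # b) = remove_first (\<lambda>c. (s, c) \<in> G) (a @ b)"
        then show ?thesis using L0 by (auto simp: Inr intro!: mult_left_mono)
      next
        fix a' d' b'
        assume *: "remove_first (\<lambda>c. (s, c) \<in> G) (a @ d # b) = a' @ d' # b'"
          "remove_first (\<lambda>c. (s, c) \<in> G) (a @ b) = a' @ b'" and "set (d' # b') \<subseteq> set (d # b)"
        then have "set (d' # b') \<subseteq> D" using Suc.prems by blast
        from Suc.IH[OF this, of a'] show ?thesis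
          by (auto simp: Inr * intro!: mult_left_mono)
      qed
    qed
    then have "next_mean (hit_time n) (a @ b) \<le> next_mean (hit_time n) (a @ d # b)"
      unfolding next_mean_def by (intro sum_mono) blast
    moreover have "next_mean (hit_time n) (a @ d # b) \<le> next_mean (\<lambda>x. hit_time n x + L) (a @ b)"
      unfolding next_mean_def by (intro sum_mono) (use le in blast)
    ultimately show ?thesis using False by (auto simp: next_mean_add)
  qed
qed

text \<open>From the empty list the chain moves to \<open>[c]\<close> with probability
  \<open>lam c / r\<close>, so Kac's bound on the mean after that step limits
  \<open>hit_time n [c]\<close>.\<close>

lemma hit_time_arrival_bound:
  obtains L where "0 \<le> L" "\<And>c n. lam c \<noteq> 0 \<Longrightarrow> hit_time n [c] \<le> L"
proof
  define B where "B = 1 / pmf stationary [] - 1"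
  have ge0: "0 \<le> hit_time n x" for n x by (rule cost_nonneg) auto
  have B: "(\<Sum>z\<in>UNIV. pmf q z * hit_time n (step [] z)) \<le> B" for n
    using next_mean_hit_time_le[of n] by (simp add: next_mean_def B_def)
  have le: "pmf q z * hit_time n (step [] z) \<le> B" for n z
    using B[of n] ge0
    by (intro order_trans[OF member_le_sum[of z UNIV "\<lambda>z. pmf q z * hit_time n (step [] z)"]]) auto
  have B0: "0 \<le> B" using le[of "undefined" 0] by simp
  \<comment> \<open>Types of rate 0 contribute 0, since division by 0 gives 0.\<close>
  define L where "L = (\<Sum>c\<in>UNIV. B * r / lam c)"
  have nn: "0 \<le> B * r / lam c" for c using B0 r_pos lam_nonneg by simp
  show "0 \<le> L" unfolding L_def by (intro sum_nonneg nn)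
  fix c n assume "lam c \<noteq> 0"
  then have "lam c > 0" using lam_nonneg[of c] by simp
  then have "hit_time n [c] \<le> B * r / lam c"
    using le[of "Agent c" n] r_pos by (simp add: pmf_agent field_simps)
  also have "\<dots> \<le> L"
    unfolding L_def by (intro member_le_sum nn) auto
  finally show "hit_time n [c] \<le> L" .
qed

text \<open>Types that never arrive may still occur in the initial state. They wait at the head of
  the list until the first compatible good, and meanwhile only arriving types pile up behind.\<close>

lemma hit_time_singleton_bound:
  obtains L where "0 \<le> L" "\<And>c n. hit_time n [c] \<le> L"
proof -
  obtain L where L: "0 \<le> L" "\<And>c n. lam c \<noteq> 0 \<Longrightarrow> hit_time n [c] \<le> L"
    using hit_time_arrival_bound by blast
  define \<delta> where "\<delta> c = cap {c} / r" for c
  \<comment> \<open>\<open>K c\<close> solves 1 + (K + L) - K * \<open>\<delta> c\<close> = K. Here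
    \<open>\<delta> c\<close> is the probability that the next item is a good compatible with c,
    which empties the list; otherwise at most one arriving agent joins, at a cost of at most
    L.\<close>
  define K where "K c = (1 + L) / \<delta> c" for c
  have \<delta>: "0 < \<delta> c" for c
    using cap_pos[of "{c}"] r_pos by (simp add: \<delta>_def)
  have K: "0 \<le> K c" for c
    using \<delta>[of c] L by (simp add: K_def)
  have le: "hit_time n [c] \<le> K c" for c n
  proof (induction n)
    case (Suc n)
    have "pmf q z * hit_time n (step [c] z) \<le>
        pmf q z * (K c + L) - K c * (pmf q z * of_bool (\<exists>s. z = Good s \<and> (s, c) \<in> G))" for z
    proof (cases z)
      case (Inl d)
      have "pmf q z * hit_time n [c, d] \<le> pmf q z * (hit_time n [c] + L)"
      proof (cases "lam d = 0")
        case False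
        then show ?thesis
          using hit_time_insert[of "{d. lam d \<noteq> 0}" L d "[]" n "[c]"] L
          by (intro mult_left_mono) auto
      qed (simp add: Inl pmf_agent)
      also have "\<dots> \<le> pmf q z * (K c + L)"
        by (intro mult_left_mono add_right_mono Suc) simp
      finally show ?thesis by (simp add: Inl)
    next
      case (Inr s)
      have "pmf q z * hit_time n [c] \<le> pmf q z * (K c + L)"
        using Suc L by (intro mult_left_mono) auto
      then show ?thesis
        using K[of c] L by (auto simp: Inr algebra_simps)
    qed
    then have "next_mean (hit_time n) [c] \<le>
        (\<Sum>z\<in>UNIV. pmf q z * (K c + L) - K c * (pmf q z * of_bool (\<exists>s. z = Good s \<and> (s, c) \<in> G)))"
      unfolding next_mean_def by (intro sum_mono)
    also have "\<dots> = K c + L - K c * (\<Sum>z\<in>UNIV. pmf q z * of_bool (\<exists>s. z = Good s \<and> (s, c) \<in> G))"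
      by (simp add: sum_subtractf sum_pmf_eq_1 flip: sum_distrib_left sum_distrib_right)
    also have "(\<Sum>z\<in>UNIV. pmf q z * of_bool (\<exists>s. z = Good s \<and> (s, c) \<in> G)) = \<delta> c"
      by (simp add: sum_items pmf_good \<delta>_def cap_def goods_of_def sum_divide_distrib of_bool_def
        mult_delta_right sum.If_cases)
    also have "K c + L - K c * \<delta> c = K c - 1"
      using \<delta>[of c] by (simp add: K_def)
    finally show ?case by simp
  qed (simp add: K)
  show thesis
  proof
    show "0 \<le> (\<Sum>c\<in>UNIV. K c)" by (intro sum_nonneg K)
    show "hit_time n [c] \<le> (\<Sum>c\<in>UNIV. K c)" for c n
      using le[of n c] member_le_sum[of c UNIV K] K by fastforce
  qed
qed

lemma hit_time_insert_bound:
  "\<exists>L\<ge>0. \<forall>n a b d. hit_time n (a @ b) \<le> hit_time n (a @ d # b) \<and>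
    hit_time n (a @ d # b) \<le> hit_time n (a @ b) + L"
proof -
  obtain L where L: "0 \<le> L" "\<And>c n. hit_time n [c] \<le> L"
    using hit_time_singleton_bound by blast
  show ?thesis
    using hit_time_insert[of UNIV L] L by (intro exI[of _ L]) auto
qed

lemma bdd_above_hit_time: "bdd_above (range (\<lambda>n. hit_time n x))"
proof -
  obtain L where insert: "\<forall>n a b d. hit_time n (a @ d # b) \<le> hit_time n (a @ b) + L"
    using hit_time_insert_bound by blast
  have "hit_time n x \<le> L * length x" for n
  proof (induction x)
    case (Cons d b)
    then show ?case using insert[rule_format, where n = n and a = "[]" and d = d and b = b] by (simp add: algebra_simps)
  qed simp
  then show ?thesis by (auto intro!: bdd_aboveI2)
qed

lemma hit_time_step_bound: "\<exists>L. \<forall>n x z. \<bar>hit_time n (step x z) - hit_time n x\<bar> \<le> L"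
proof -
  obtain L where L: "0 \<le> L"
    and insert: "\<forall>n a b d. hit_time n (a @ b) \<le> hit_time n (a @ d # b) \<and>
      hit_time n (a @ d # b) \<le> hit_time n (a @ b) + L"
    using hit_time_insert_bound by blast
  have "\<bar>hit_time n (step x z) - hit_time n x\<bar> \<le> L" for n x z
  proof (cases z)
    case (Inl c)
    then show ?thesis using insert[rule_format, where n = n and a = x and d = c and b = "[]"] L by simp
  next
    case (Inr s)
    show ?thesis
    proof (cases rule: remove_first_cases[where xs = x and P = "\<lambda>c. (s, c) \<in> G"])
      case none
      then show ?thesis using L by (simp add: Inr)
    next
      case (some a d b)
      then show ?thesis using insert[rule_format, where n = n and a = a and b = b and d = d] L by (simp add: Inr)
    qed
  qed
  then show ?thesis by blast
qed

end

section \<open>Matchings as queues\<close>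

lemma find_eq_Some_take:
  "find P xs = Some c \<longleftrightarrow> P c \<and> (\<exists>l<length xs. xs ! l = c \<and> (\<forall>x\<in>set (take l xs). \<not> P x))"
proof -
  have "(\<forall>x\<in>set (take l xs). \<not> P x) \<longleftrightarrow> (\<forall>j<l. \<not> P (xs ! j))" if "l < length xs" for l
    using that by (auto simp: all_set_conv_all_nth)
  then show ?thesis
    unfolding find_Some_iff by (simp cong: conj_cong) blast
qed

lemma remove_first_eq_remove1:
  assumes "find P xs = Some m"
  shows "remove_first P xs = remove1 m xs"
proof -
  have "P m" using assms by (auto simp: find_Some_iff)
  then show ?thesis using assms by (induction xs) (auto split: if_splits)
qed

lemma remove_first_eq_id: "find P xs = None \<Longrightarrow> remove_first P xs = xs"
  by (induction xs) (auto split: if_splits)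

lemma map_remove_first: "map f (remove_first (P \<circ> f) xs) = remove_first P (map f xs)"
  by (induction xs) auto

lemma find_map: "find P (map f xs) = map_option f (find (P \<circ> f) xs)"
  by (induction xs) auto

lemma int_le_add_1_iff: "l \<le> n + 1 \<longleftrightarrow> l \<le> n \<or> l = n + 1" for l n :: int
  by auto

lemma sorted_list_of_set_insert_Max:
  fixes A :: "'a::linorder set"
  assumes "finite A" "\<And>x. x \<in> A \<Longrightarrow> x < m"
  shows "sorted_list_of_set (insert m A) = sorted_list_of_set A @ [m]"
proof (rule sorted_distinct_set_unique[OF sorted_sorted_list_of_set distinct_sorted_list_of_set])
  show "sorted (sorted_list_of_set A @ [m])" "distinct (sorted_list_of_set A @ [m])"
    using assms by (auto simp: sorted_append less_imp_le)
  have "set (sorted_list_of_set (insert m A)) = insert m A"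
    using assms by (intro set_sorted_list_of_set) simp
  then show "set (sorted_list_of_set (insert m A)) = set (sorted_list_of_set A @ [m])"
    using assms by simp
qed

context
  fixes G :: "('s::finite \<times> 'c::finite) set" and w :: "int \<Rightarrow> ('c, 's) item" and A :: "(int \<times> int) set"
  assumes matching: "directed_fcfs_matching G w A"
begin

lemma match_unique: "(n, m) \<in> A \<Longrightarrow> (n, m') \<in> A \<Longrightarrow> m = m'" "(n, m) \<in> A \<Longrightarrow> (n', m) \<in> A \<Longrightarrow> n = n'"
  using matching unfolding directed_fcfs_matching_def by blast+

lemma match_types: "(n, m) \<in> A \<Longrightarrow> \<exists>s c. w n = Good s \<and> w m = Agent c"
  using matching unfolding directed_fcfs_matching_def by blast

lemma match_iff:
  "w n = Good s \<Longrightarrow> w m = Agent c \<Longrightarrow> (n, m) \<in> A \<longleftrightarrow>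
    m < n \<and> (s, c) \<in> G \<and>
    (\<forall>k<m. \<forall>c'. w k = Agent c' \<and> (s, c') \<in> G \<longrightarrow> (\<exists>l<n. (l, k) \<in> A)) \<and>
    (\<forall>l<n. (l, m) \<notin> A)"
proof -
  assume types: "w n = Good s" "w m = Agent c"
  have "\<forall>n m s c. w n = Good s \<and> w m = Agent c \<longrightarrow>
        ((n, m) \<in> A \<longleftrightarrow>
           n > m \<and> (s, c) \<in> G \<and>
           (\<forall>k<m. \<forall>c'. w k = Agent c' \<and> (s, c') \<in> G \<longrightarrow> (\<exists>l<n. (l, k) \<in> A)) \<and>
           (\<forall>l<n. (l, m) \<notin> A))"
    using matching unfolding directed_fcfs_matching_def by (elim conjE)
  from this[THEN spec, THEN spec, THEN spec, THEN spec, THEN mp, OF conjI, OF types]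
  show ?thesis .
qed

definition waiting :: "int \<Rightarrow> int set" where
  "waiting n = {m. m \<le> n \<and> (\<exists>c. w m = Agent c) \<and> (\<forall>l\<le>n. (l, m) \<notin> A)}"

text \<open>This is X(n). \<open>sorted_list_of_set\<close> gives [] for an infinite set, so the
  definition has its intended meaning only by \<open>finite_waiting\<close>.\<close>

definition queue :: "int \<Rightarrow> 'c list" where
  "queue n = map (projl \<circ> w) (sorted_list_of_set (waiting n))"

text \<open>If infinitely many agents of one type were waiting, then each good that takes one of them
  would have to be preceded by the goods taking infinitely many earlier ones.\<close>

lemma finite_waiting:
  assumes all: "all_agents_matched w A"
  shows "finite (waiting n)"
proof (rule ccontr)
  assume "infinite (waiting n)"
  have "\<exists>c. infinite {m \<in> waiting n. w m = Agent c}"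
  proof (rule ccontr)
    assume "\<not> (\<exists>c. infinite {m \<in> waiting n. w m = Agent c})"
    then have "finite (\<Union>c. {m \<in> waiting n. w m = Agent c})" by simp
    also have "(\<Union>c. {m \<in> waiting n. w m = Agent c}) = waiting n" by (auto simp: waiting_def)
    finally show False using \<open>infinite (waiting n)\<close> by simp
  qed
  then obtain c where inf: "infinite {m \<in> waiting n. w m = Agent c}" by blast
  define K where "K = {m \<in> waiting n. w m = Agent c}"
  have "K \<noteq> {}" using inf unfolding K_def by force
  then obtain m0 where m0: "m0 \<in> K" by blast
  then obtain p where p: "(p, m0) \<in> A"
    using all by (auto simp: K_def all_agents_matched_def)
  obtain s where s: "w p = Good s" using match_types[OF p] by blast
  have m0_type: "w m0 = Agent c" using m0 by (simp add: K_def)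
  note iff = match_iff[OF s m0_type]
  have "\<exists>l. n < l \<and> l < p \<and> (l, k) \<in> A" if "k \<in> K" "k < m0" for k
  proof -
    have "\<exists>l<p. (l, k) \<in> A" using p that unfolding iff by (auto simp: K_def)
    then show ?thesis using that by (auto simp: K_def waiting_def) (meson not_le)
  qed
  then have "\<forall>k\<in>{k \<in> K. k < m0}. \<exists>l. n < l \<and> l < p \<and> (l, k) \<in> A" by blast
  from bchoice[OF this] obtain l
    where l: "\<forall>k\<in>{k \<in> K. k < m0}. n < l k \<and> l k < p \<and> (l k, k) \<in> A" by blast
  have "inj_on l {k \<in> K. k < m0}"
  proof (rule inj_onI)
    fix k k' assume k: "k \<in> {k \<in> K. k < m0}" "k' \<in> {k \<in> K. k < m0}" and "l k = l k'"
    then have "(l k, k) \<in> A" "(l k, k') \<in> A" using l by (metis, metis)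
    then show "k = k'" by (rule match_unique(1))
  qed
  moreover have "l ` {k \<in> K. k < m0} \<subseteq> {n<..<p}" using l by auto
  ultimately have "finite {k \<in> K. k < m0}"
    by (rule inj_on_finite) simp
  moreover have "K \<subseteq> {k \<in> K. k < m0} \<union> {m0..n}" by (auto simp: K_def waiting_def)
  ultimately have "finite K" by (meson finite_UnI finite_atLeastAtMost_int finite_subset)
  then show False using inf by (simp add: K_def)
qed

context
  assumes all: "all_agents_matched w A"
begin

lemma set_sorted_waiting [simp]: "set (sorted_list_of_set (waiting n)) = waiting n"
  by (simp add: finite_waiting[OF all])

lemma queue_agent:
  assumes "w (n + 1) = Agent c"
  shows "queue (n + 1) = queue n @ [c]"
proof -
  have "(l, n + 1) \<notin> A" if "l \<le> n + 1" for l
  proof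
    assume "(l, n + 1) \<in> A"
    moreover from match_types[OF this] obtain s where "w l = Good s" by blast
    ultimately show False using match_iff[OF _ assms, of l s] that by simp
  qed
  moreover have "(n + 1, m) \<notin> A" for m
    using match_types[of "n + 1" m] assms by auto
  ultimately have eq: "waiting (n + 1) = insert (n + 1) (waiting n)"
    using assms by (auto simp: waiting_def int_le_add_1_iff)
  have "sorted_list_of_set (waiting (n + 1)) = sorted_list_of_set (waiting n) @ [n + 1]"
    unfolding eq
    by (rule sorted_list_of_set_insert_Max[OF finite_waiting[OF all]]) (auto simp: waiting_def)
  then show ?thesis using assms by (simp add: queue_def)
qed

text \<open>Positions are sorted, so \<open>find\<close> returns the least compatible waiting
  position. On the matching side, clause (iii) says that no earlier compatible agent is still
  waiting, and the availability clause that m itself is.\<close>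

lemma match_iff_find:
  assumes "w (n + 1) = Good s"
  shows "(n + 1, m) \<in> A \<longleftrightarrow>
    find ((\<lambda>c. (s, c) \<in> G) \<circ> (projl \<circ> w)) (sorted_list_of_set (waiting n)) = Some m"
proof -
  let ?P = "(\<lambda>c. (s, c) \<in> G) \<circ> (projl \<circ> w)"
  let ?L = "sorted_list_of_set (waiting n)"
  have P: "?P k \<longleftrightarrow> (s, c) \<in> G" if "w k = Agent c" for k c using that by simp
  have sorted: "sorted_wrt (<) ?L" by simp
  have in_nth: "\<exists>j<length ?L. k = ?L ! j" if "k \<in> waiting n" for k
  proof -
    have "k \<in> set ?L" using that by simp
    then show ?thesis by (auto simp only: in_set_conv_nth)
  qed
  have nth_in: "?L ! j \<in> waiting n" if "j < length ?L" for j
    using nth_mem[OF that] by simp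
  have "find ?P ?L = Some m \<longleftrightarrow> m \<in> waiting n \<and> ?P m \<and> (\<forall>k\<in>waiting n. k < m \<longrightarrow> \<not> ?P k)"
  proof
    assume "find ?P ?L = Some m"
    then obtain i where i: "i < length ?L" "?P m" "m = ?L ! i" "\<forall>j<i. \<not> ?P (?L ! j)"
      unfolding find_Some_iff by blast
    have "\<not> ?P k" if k: "k \<in> waiting n" "k < m" for k
    proof -
      obtain j where j: "j < length ?L" "k = ?L ! j"
        using in_nth[OF k(1)] by blast
      have "j < i"
      proof (rule ccontr)
        assume "\<not> j < i"
        then have "m \<le> k" using sorted_nth_mono[of ?L i j] i j by simp
        then show False using k by simp
      qed
      then show ?thesis using i j by blast
    qed
    moreover have "m \<in> waiting n" using i nth_in by blast
    ultimately show "m \<in> waiting n \<and> ?P m \<and> (\<forall>k\<in>waiting n. k < m \<longrightarrow> \<not> ?P k)" using i by blast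
  next
    assume m: "m \<in> waiting n \<and> ?P m \<and> (\<forall>k\<in>waiting n. k < m \<longrightarrow> \<not> ?P k)"
    then obtain i where i: "i < length ?L" "m = ?L ! i"
      using in_nth[of m] by blast
    have "\<not> ?P (?L ! j)" if "j < i" for j
    proof -
      have "?L ! j < m" using sorted_wrt_nth_less[OF sorted that] i by simp
      moreover have "?L ! j \<in> waiting n"
        using i that by (intro nth_in) simp
      ultimately show ?thesis using m by blast
    qed
    then show "find ?P ?L = Some m" unfolding find_Some_iff using i m by blast
  qed
  also have "\<dots> \<longleftrightarrow> (n + 1, m) \<in> A"
  proof
    assume m: "(n + 1, m) \<in> A"
    then obtain c where c: "w m = Agent c" using match_types by blast
    have *: "m < n + 1" "(s, c) \<in> G" "\<And>l. l < n + 1 \<Longrightarrow> (l, m) \<notin> A"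
      "\<And>k c'. k < m \<Longrightarrow> w k = Agent c' \<Longrightarrow> (s, c') \<in> G \<Longrightarrow> \<exists>l<n + 1. (l, k) \<in> A"
      using m unfolding match_iff[OF assms c] by auto
    have "m \<in> waiting n" using * c by (auto simp: waiting_def)
    moreover have "\<not> ?P k" if k: "k \<in> waiting n" "k < m" for k
    proof
      assume "?P k"
      obtain c' where c': "w k = Agent c'" using k(1) unfolding waiting_def by blast
      then obtain l where "l < n + 1" "(l, k) \<in> A" using *(4)[OF k(2) c'] \<open>?P k\<close> by auto
      then show False using k by (auto simp: waiting_def)
    qed
    ultimately show "m \<in> waiting n \<and> ?P m \<and> (\<forall>k\<in>waiting n. k < m \<longrightarrow> \<not> ?P k)"
      using * c by simp
  next
    assume m: "m \<in> waiting n \<and> ?P m \<and> (\<forall>k\<in>waiting n. k < m \<longrightarrow> \<not> ?P k)"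
    then obtain c where c: "w m = Agent c" by (auto simp: waiting_def)
    have "\<exists>l<n + 1. (l, k) \<in> A" if "k < m" "w k = Agent c'" "(s, c') \<in> G" for k c'
    proof -
      have "k \<notin> waiting n" using m that by auto
      then show ?thesis using that m by (auto simp: waiting_def)
    qed
    moreover have "m < n + 1" "\<And>l. l < n + 1 \<Longrightarrow> (l, m) \<notin> A" using m by (auto simp: waiting_def)
    moreover have "(s, c) \<in> G" using m c by simp
    ultimately show "(n + 1, m) \<in> A" unfolding match_iff[OF assms c] by blast
  qed
  finally show ?thesis by blast
qed

lemma find_queue:
  assumes "w (n + 1) = Good s"
  shows "find (\<lambda>c. (s, c) \<in> G) (queue n) = Some c \<longleftrightarrow> (\<exists>m. (n + 1, m) \<in> A \<and> w m = Agent c)"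
    and "find (\<lambda>c. (s, c) \<in> G) (queue n) = None \<longleftrightarrow> (\<nexists>m. (n + 1, m) \<in> A)"
proof -
  have "\<exists>c. w m = Agent c" if "(n + 1, m) \<in> A" for m
    using match_types[OF that] by blast
  then show "find (\<lambda>c. (s, c) \<in> G) (queue n) = Some c \<longleftrightarrow> (\<exists>m. (n + 1, m) \<in> A \<and> w m = Agent c)"
    unfolding queue_def find_map match_iff_find[OF assms] by fastforce
  show "find (\<lambda>c. (s, c) \<in> G) (queue n) = None \<longleftrightarrow> (\<nexists>m. (n + 1, m) \<in> A)"
    unfolding queue_def find_map match_iff_find[OF assms] by auto
qed

lemma queue_good:
  assumes "w (n + 1) = Good s"
  shows "queue (n + 1) = remove_first (\<lambda>c. (s, c) \<in> G) (queue n)"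
proof -
  let ?P = "(\<lambda>c. (s, c) \<in> G) \<circ> (projl \<circ> w)"
  let ?L = "sorted_list_of_set (waiting n)"
  have eq: "waiting (n + 1) = waiting n - {m. (n + 1, m) \<in> A}"
    using assms by (auto simp: waiting_def int_le_add_1_iff)
  have "sorted_list_of_set (waiting (n + 1)) = remove_first ?P ?L"
  proof (cases "find ?P ?L")
    case None
    then have "waiting (n + 1) = waiting n"
      unfolding eq by (auto simp: match_iff_find[OF assms])
    then show ?thesis using None by (simp add: remove_first_eq_id)
  next
    case (Some m)
    then have "waiting (n + 1) = waiting n - {m}"
      unfolding eq by (auto simp: match_iff_find[OF assms])
    then show ?thesis
      using Some by (simp add: remove_first_eq_remove1 sorted_list_of_set_remove finite_waiting[OF all])
  qed
  then show ?thesis by (simp add: queue_def map_remove_first)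
qed

end

end

section \<open>Long-run matching fractions\<close>

text \<open>Needed to pass from the two-sided sequence to positions 1, 2, ...; \<open>inv f\<close>
  carries the events back to the original indices.\<close>

lemma (in prob_space) indep_vars_reindex:
  assumes "indep_vars M' X UNIV" and "inj f"
  shows "indep_vars (\<lambda>i. M' (f i)) (\<lambda>i. X (f i)) UNIV"
  unfolding indep_vars_def2
proof (intro conjI ballI indep_setsI)
  have rv: "random_variable (M' i) (X i)" for i
    using assms(1) by (auto simp: indep_vars_def)
  then show "random_variable (M' (f i)) (X (f i))" for i .
  show "{X (f i) -` A \<inter> space M |A. A \<in> sets (M' (f i))} \<subseteq> events" for i
    using rv by (auto intro: measurable_sets)
  fix A J assume J: "J \<noteq> {}" "J \<subseteq> UNIV" "finite J"
    and A: "\<forall>j\<in>J. A j \<in> {X (f j) -` A \<inter> space M |A. A \<in> sets (M' (f j))}"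
  from bchoice[of J "\<lambda>j B. A j = X (f j) -` B \<inter> space M \<and> B \<in> sets (M' (f j))"] A
  obtain B where B: "\<And>j. j \<in> J \<Longrightarrow> A j = X (f j) -` B j \<inter> space M" "\<And>j. j \<in> J \<Longrightarrow> B j \<in> sets (M' (f j))"
    by auto
  have inv: "inv f (f j) = j" for j using assms(2) by simp
  have "prob (\<Inter>i\<in>f ` J. X i -` B (inv f i) \<inter> space M) = (\<Prod>i\<in>f ` J. prob (X i -` B (inv f i) \<inter> space M))"
    using J B by (intro indep_varsD[OF assms(1)]) (auto simp: inv)
  also have "(\<Inter>i\<in>f ` J. X i -` B (inv f i) \<inter> space M) = (\<Inter>j\<in>J. A j)"
    using B by (simp add: inv)
  also have "(\<Prod>i\<in>f ` J. prob (X i -` B (inv f i) \<inter> space M)) = (\<Prod>j\<in>J. prob (A j))"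
    using B assms(2) by (subst prod.reindex) (auto simp: inv intro: inj_on_subset)
  finally show "prob (\<Inter>j\<in>J. A j) = (\<Prod>j\<in>J. prob (A j))" .
qed

text \<open>Step k of the chain, counted from 0, reads position k + 1, and the good there faces the
  list left after position k.\<close>

lemma real_card_positions:
  "real (card {n \<in> {1..int N}. P n}) = (\<Sum>k<N. of_bool (P (int k + 1)))"
proof -
  have "bij_betw (\<lambda>k. int k + 1) {k. k < N \<and> P (int k + 1)} {n \<in> {1..int N}. P n}"
    by (rule bij_betwI[where g = "\<lambda>n. nat (n - 1)"]) auto
  then have "card {n \<in> {1..int N}. P n} = card {k. k < N \<and> P (int k + 1)}"
    by (rule bij_betw_same_card[symmetric])
  also have "real \<dots> = (\<Sum>k<N. of_bool (P (int k + 1)))"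
    by (simp add: of_bool_def sum.If_cases Int_def)
  finally show ?thesis .
qed

lemma tendsto_divide_averages:
  fixes a b :: "nat \<Rightarrow> real"
  assumes "(\<lambda>n. a n / real n) \<longlonglongrightarrow> A" "(\<lambda>n. b n / real n) \<longlonglongrightarrow> B" "B \<noteq> 0"
  shows "(\<lambda>n. a n / b n) \<longlonglongrightarrow> A / B"
proof (rule Lim_transform_eventually[OF tendsto_divide[OF assms]])
  show "\<forall>\<^sub>F n in sequentially. a n / real n / (b n / real n) = a n / b n"
    using eventually_gt_at_top[of 0] by eventually_elim simp
qed

context fcfs_queue
begin

lemma queue_eq_state:
  assumes "directed_fcfs_matching G w A" "all_agents_matched w A"
  shows "queue w A (int k) = state step (queue w A 0) (\<lambda>i. w (int i + 1)) k"
proof (induction k)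
  case (Suc k)
  have "queue w A (int k + 1) = step (queue w A (int k)) (w (int k + 1))"
    using queue_agent[OF assms] queue_good[OF assms] by (cases "w (int k + 1)") auto
  then show ?case using Suc by (simp add: add.commute)
qed simp

lemma measure_find_Some:
  assumes "(s, c) \<in> G"
  shows "measure stationary {x. find (\<lambda>c. (s, c) \<in> G) x = Some c} =
    (\<Sum>k = 1..CARD('c). \<Sum>C | card C = k. \<Sum>Cs\<in>permutations_of_set C.
      pi_Y G lam mu Cs * of_bool (\<exists>l<k. Cs ! l = c \<and> set (take l Cs) \<inter> agents_of G s = {}))"
proof -
  let ?Q = "\<lambda>Cs. \<exists>l<length Cs. Cs ! l = c \<and> set (take l Cs) \<inter> agents_of G s = {}"
  have "find (\<lambda>c. (s, c) \<in> G) x = Some c \<longleftrightarrow> ?Q (fresh {} x)" for x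
    using assms find_fresh[of "{}" "\<lambda>c. (s, c) \<in> G" x] find_eq_Some_take[of "\<lambda>c. (s, c) \<in> G" "fresh {} x" c]
    by (auto simp: agents_of_def disjoint_iff)
  then have "measure stationary {x. find (\<lambda>c. (s, c) \<in> G) x = Some c} = measure stationary {x. ?Q (fresh {} x)}"
    by simp
  also have "\<dots> = (\<Sum>k = 1..CARD('c). \<Sum>C | card C = k. \<Sum>Cs\<in>permutations_of_set C.
      pi_Y G lam mu Cs * of_bool (?Q Cs))"
    by (rule measure_stationary_eq_sum_pi_Y) auto
  also have "\<dots> = (\<Sum>k = 1..CARD('c). \<Sum>C | card C = k. \<Sum>Cs\<in>permutations_of_set C.
      pi_Y G lam mu Cs * of_bool (\<exists>l<k. Cs ! l = c \<and> set (take l Cs) \<inter> agents_of G s = {}))"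
    by (intro sum.cong refl) (auto simp: length_finite_permutations_of_set)
  finally show ?thesis .
qed

lemma measure_find_None:
  "measure stationary {x. find (\<lambda>c. (s, c) \<in> G) x = None} =
    (\<Sum>k = 0..CARD('c). \<Sum>C | card C = k. \<Sum>Cs\<in>permutations_of_set C.
      pi_Y G lam mu Cs * of_bool (set Cs \<inter> agents_of G s = {}))"
proof -
  have "find (\<lambda>c. (s, c) \<in> G) x = None \<longleftrightarrow> set (fresh {} x) \<inter> agents_of G s = {}" for x
    using find_fresh[of "{}" "\<lambda>c. (s, c) \<in> G" x] find_None_iff[of "\<lambda>c. (s, c) \<in> G" "fresh {} x"]
    by (auto simp: agents_of_def disjoint_iff)
  then show ?thesis
    using measure_stationary_eq_sum_pi_Y[of "\<lambda>Cs. set Cs \<inter> agents_of G s = {}" 0] by simp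
qed

text \<open>Purely deterministic: on a path with the right joint frequencies, the fate of a good is
  read off from \<open>find\<close> on the list before it. The set UNIV counts all goods and gives
  the denominator, of frequency \<open>sum mu UNIV / r\<close>; hence r cancels.\<close>

theorem matching_fractions_tendsto:
  fixes w :: "int \<Rightarrow> ('c, 's) item"
  assumes freq: "\<And>x E a. E \<in> insert UNIV (range (\<lambda>(s, oc). {x. find (\<lambda>c. (s, c) \<in> G) x = oc})) \<Longrightarrow>
      (\<lambda>n. (\<Sum>k<n. indicator E (state step x (\<lambda>i. w (int i + 1)) k) * of_bool (w (int k + 1) = a)) / real n)
        \<longlonglongrightarrow> measure stationary E * pmf q a"
    and A: "directed_fcfs_matching G w A" "all_agents_matched w A"
    and goods: "sum mu UNIV > 0"
  shows "(\<lambda>N. matched_fraction w A s c N) \<longlonglongrightarrow>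
      mu s / sum mu UNIV * measure stationary {x. find (\<lambda>c. (s, c) \<in> G) x = Some c}" (is ?matched)
    and "(\<lambda>N. unmatched_fraction w A s N) \<longlonglongrightarrow>
      mu s / sum mu UNIV * measure stationary {x. find (\<lambda>c. (s, c) \<in> G) x = None}" (is ?unmatched)
proof -
  let ?X = "state step (queue w A 0) (\<lambda>i. w (int i + 1))"
  let ?find = "find (\<lambda>c. (s, c) \<in> G)"
  have "(\<lambda>n. \<Sum>s\<in>UNIV. (\<Sum>k<n. indicator UNIV (?X k) * of_bool (w (int k + 1) = Good s)) / real n)
      \<longlonglongrightarrow> (\<Sum>s\<in>UNIV. measure stationary UNIV * pmf q (Good s))"
    by (intro tendsto_sum freq) simp
  also have "(\<Sum>s\<in>UNIV. measure stationary UNIV * pmf q (Good s)) = sum mu UNIV / r"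
    by (simp add: pmf_good sum_divide_distrib)
  also have "(\<lambda>n. \<Sum>s\<in>UNIV. (\<Sum>k<n. indicator UNIV (?X k) * of_bool (w (int k + 1) = Good s)) / real n) =
      (\<lambda>n. real (card (good_positions w n)) / real n)"
  proof
    fix n
    have "(\<Sum>s\<in>UNIV. of_bool (w k = Good s)) = (of_bool (\<exists>s. w k = Good s) :: real)" for k
      by (cases "w k") (auto simp: of_bool_def)
    then have "real (card (good_positions w n)) = (\<Sum>k<n. \<Sum>s\<in>UNIV. of_bool (w (int k + 1) = Good s))"
      unfolding good_positions_def real_card_positions by simp
    also have "\<dots> = (\<Sum>s\<in>UNIV. \<Sum>k<n. indicator UNIV (?X k) * of_bool (w (int k + 1) = Good s))"
      by (subst sum.swap) simp
    finally show "(\<Sum>s\<in>UNIV. (\<Sum>k<n. indicator UNIV (?X k) * of_bool (w (int k + 1) = Good s)) / real n) =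
        real (card (good_positions w n)) / real n"
      by (simp add: sum_divide_distrib)
  qed
  finally have den: "(\<lambda>n. real (card (good_positions w n)) / real n) \<longlonglongrightarrow> sum mu UNIV / r" .
  have lim: "(\<lambda>N. real (card {n \<in> {1..int N}. w n = Good s \<and> ?find (queue w A (n - 1)) = oc}) /
      real (card (good_positions w N))) \<longlonglongrightarrow> mu s / sum mu UNIV * measure stationary {x. ?find x = oc}" for oc
  proof -
    have num: "(\<lambda>n. real (card {m \<in> {1..int n}. w m = Good s \<and> ?find (queue w A (m - 1)) = oc}) / real n)
        \<longlonglongrightarrow> measure stationary {x. ?find x = oc} * pmf q (Good s)"
    proof -
      have "real (card {m \<in> {1..int n}. w m = Good s \<and> ?find (queue w A (m - 1)) = oc}) =
          (\<Sum>k<n. indicator {x. ?find x = oc} (?X k) * of_bool (w (int k + 1) = Good s))" for n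
        unfolding real_card_positions
        by (intro sum.cong) (auto simp: queue_eq_state[OF A] indicator_def)
      then show ?thesis
        using freq[of "{x. ?find x = oc}" "queue w A 0" "Good s"] by auto
    qed
    have "measure stationary {x. ?find x = oc} * pmf q (Good s) / (sum mu UNIV / r) =
        mu s / sum mu UNIV * measure stationary {x. ?find x = oc}"
      using r_pos by (simp add: pmf_good)
    moreover have "sum mu UNIV / r \<noteq> 0" using goods r_pos by simp
    ultimately show ?thesis using tendsto_divide_averages[OF num den] by metis
  qed
  have match: "?find (queue w A (n - 1)) = Some c \<longleftrightarrow> (\<exists>m. (n, m) \<in> A \<and> w m = Agent c)"
    "?find (queue w A (n - 1)) = None \<longleftrightarrow> (\<nexists>m. (n, m) \<in> A)" if "w n = Good s" for n c
    using find_queue[OF A, of "n - 1" s] that by auto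
  have "{n \<in> good_positions w N. w n = Good s \<and> (\<exists>m. (n, m) \<in> A \<and> w m = Agent c)} =
      {n \<in> {1..int N}. w n = Good s \<and> ?find (queue w A (n - 1)) = Some c}" for N
    unfolding good_positions_def using match by blast
  then show ?matched
    using lim[of "Some c"] by (simp add: matched_fraction_def)
  have "{n \<in> good_positions w N. w n = Good s \<and> (\<nexists>m. (n, m) \<in> A)} =
      {n \<in> {1..int N}. w n = Good s \<and> ?find (queue w A (n - 1)) = None}" for N
    unfolding good_positions_def using match by blast
  then show ?unmatched
    using lim[of None] by (simp add: unmatched_fraction_def)
qed

end

theorem theorem7:
  fixes M :: "'w measure"
    and z :: "int \<Rightarrow> 'w \<Rightarrow> ('c::finite, 's::finite) item"
    and G :: "('s \<times> 'c) set"
    and lbar mbar :: real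
    and alpha lam :: "'c \<Rightarrow> real"
    and beta mu :: "'s \<Rightarrow> real"
  assumes "prob_space M"
    and "lbar > 0" and "mbar > 0"
    and "\<And>c. alpha c \<ge> 0" and "(\<Sum>c\<in>UNIV. alpha c) = 1"
    and "\<And>s. beta s \<ge> 0" and "(\<Sum>s\<in>UNIV. beta s) = 1"
    and "lam = (\<lambda>c. lbar * alpha c)" and "mu = (\<lambda>s. mbar * beta s)"
    and "prob_space.indep_vars M (\<lambda>_. count_space UNIV) z UNIV"
    and "\<And>n c. measure M {\<omega> \<in> space M. z n \<omega> = Agent c} = lam c / (lbar + mbar)"
    and "\<And>n s. measure M {\<omega> \<in> space M. z n \<omega> = Good s} = mu s / (lbar + mbar)"
    and "stability_condition G lam mu"
  shows "AE \<omega> in M. \<forall>A.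
    directed_fcfs_matching G (\<lambda>n. z n \<omega>) A \<and> all_agents_matched (\<lambda>n. z n \<omega>) A \<longrightarrow>
      (\<forall>s c. (s, c) \<in> G \<longrightarrow>
         matched_fraction (\<lambda>n. z n \<omega>) A s c \<longlonglongrightarrow>
           mu s / mbar *
           (\<Sum>k = 1..CARD('c). \<Sum>C | card C = k. \<Sum>Cs\<in>permutations_of_set C.
              pi_Y G lam mu Cs *
              of_bool (\<exists>l<k. Cs ! l = c \<and> set (take l Cs) \<inter> agents_of G s = {}))) \<and>
      (\<forall>s. unmatched_fraction (\<lambda>n. z n \<omega>) A s \<longlonglongrightarrow>
           mu s / mbar *
           (\<Sum>k = 0..CARD('c). \<Sum>C | card C = k. \<Sum>Cs\<in>permutations_of_set C.
              pi_Y G lam mu Cs *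
              of_bool (set Cs \<inter> agents_of G s = {})))"
proof -
  interpret prob_space M by fact
  define r where "r = lbar + mbar"
  have r_pos: "r > 0" unfolding r_def using assms(2,3) by (rule add_pos_pos)
  have lam_nonneg: "lam c \<ge> 0" and mu_nonneg: "mu s \<ge> 0" for c s
    using assms by auto
  have sum_lam: "sum lam UNIV = lbar" and sum_mu: "sum mu UNIV = mbar"
    using assms(5,7) unfolding assms(8,9) by (simp_all flip: sum_distrib_left)
  define p where "p = case_sum (\<lambda>c. lam c / r) (\<lambda>s. mu s / r)"
  define q where "q = embed_pmf p"
  have p_nonneg: "p z \<ge> 0" for z
    using lam_nonneg mu_nonneg r_pos by (cases z) (auto simp: p_def)
  have "(\<Sum>z\<in>UNIV. p z) = (\<Sum>c\<in>UNIV. lam c / r) + (\<Sum>s\<in>UNIV. mu s / r)"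
    by (subst UNIV_Plus_UNIV[symmetric], subst sum.Plus) (auto simp: p_def)
  also have "\<dots> = 1"
    using r_pos by (simp add: sum_lam sum_mu r_def flip: sum_divide_distrib add_divide_distrib)
  finally have sum_p: "(\<Sum>z\<in>UNIV. p z) = 1" .
  have pmf_q: "pmf q z = p z" for z
    unfolding q_def
    by (rule pmf_embed_pmf) (simp_all add: p_nonneg nn_integral_count_space_finite sum_ennreal sum_p)
  interpret fcfs_queue G lam mu q r
  proof
    show "r > 0" by (fact r_pos)
    show "stability_condition G lam mu" by fact
    show "pmf q (Agent c) = lam c / r" for c by (simp only: pmf_q p_def sum.case)
    show "pmf q (Good s) = mu s / r" for s by (simp only: pmf_q p_def sum.case)
  qed
  obtain L where L: "\<forall>n x z. \<bar>hit_time n (step x z) - hit_time n x\<bar> \<le> L"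
    using hit_time_step_bound by blast
  \<comment> \<open>Position 1 is read at time 0, so the chain starts from the list after position
    0.\<close>
  define \<zeta> where "\<zeta> n = z (int n + 1)" for n
  interpret iid_stationary_chain M q \<zeta> step stationary "[]" L
  proof
    show "indep_vars (\<lambda>_. count_space UNIV) \<zeta> UNIV"
      unfolding \<zeta>_def[abs_def] using assms(10)
      by (rule indep_vars_reindex[where f = "\<lambda>n. int n + 1"]) (simp add: inj_def)
    show "prob {\<omega> \<in> space M. \<zeta> n \<omega> = a} = pmf q a" for n a
      using assms(11,12) by (cases a) (simp_all add: \<zeta>_def pmf_q p_def r_def)
    show "\<bar>hit_time n (step x z) - hit_time n x\<bar> \<le> L" for n x z
      using L by blast
  qed (fact bdd_above_hit_time)
  \<comment> \<open>Only finitely many sets are needed: one for each good type and each answer of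
    \<open>find\<close>, and UNIV.\<close>
  let ?\<E> = "insert UNIV (range (\<lambda>(s :: 's, oc :: 'c option). {x. find (\<lambda>c. (s, c) \<in> G) x = oc}))"
  have lists: "countable (UNIV :: 'c list set)"
    using countable_lists[of "UNIV :: 'c set"] by (simp add: countable_finite)
  have "countable ?\<E>" by (simp add: countable_finite)
  then have "AE \<omega> in M. \<forall>x\<in>UNIV. \<forall>E\<in>?\<E>. \<forall>a\<in>UNIV.
      (\<lambda>n. (\<Sum>k<n. indicator E (state step x (\<lambda>i. \<zeta> i \<omega>) k) * of_bool (\<zeta> k \<omega> = a)) / real n)
        \<longlonglongrightarrow> measure stationary E * pmf q a"
    by (intro AE_ball_countable' AE_joint_freq_tendsto lists) (simp_all add: countable_finite)
  then show ?thesis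
  proof eventually_elim
    case (elim \<omega>)
    show ?case
    proof (intro allI impI conjI)
      fix A s c
      assume A: "directed_fcfs_matching G (\<lambda>n. z n \<omega>) A \<and> all_agents_matched (\<lambda>n. z n \<omega>) A"
      note lim = matching_fractions_tendsto[where w = "\<lambda>n. z n \<omega>" and A = A,
          unfolded sum_mu, OF _ conjunct1[OF A] conjunct2[OF A] \<open>mbar > 0\<close>]
      have freq: "(\<lambda>n. (\<Sum>k<n. indicator E (state step x (\<lambda>i. z (int i + 1) \<omega>) k) *
          of_bool (z (int k + 1) \<omega> = a)) / real n) \<longlonglongrightarrow> measure stationary E * pmf q a"
        if "E \<in> ?\<E>" for x E a
        using elim that unfolding \<zeta>_def by blast
      show "unmatched_fraction (\<lambda>n. z n \<omega>) A s \<longlonglongrightarrow>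
           mu s / mbar *
           (\<Sum>k = 0..CARD('c). \<Sum>C | card C = k. \<Sum>Cs\<in>permutations_of_set C.
              pi_Y G lam mu Cs *
              of_bool (set Cs \<inter> agents_of G s = {}))"
        unfolding measure_find_None[symmetric] by (rule lim(2)) (rule freq)
      assume sc: "(s, c) \<in> G"
      show "matched_fraction (\<lambda>n. z n \<omega>) A s c \<longlonglongrightarrow>
           mu s / mbar *
           (\<Sum>k = 1..CARD('c). \<Sum>C | card C = k. \<Sum>Cs\<in>permutations_of_set C.
              pi_Y G lam mu Cs *
              of_bool (\<exists>l<k. Cs ! l = c \<and> set (take l Cs) \<inter> agents_of G s = {}))"
        unfolding measure_find_Some[OF sc, symmetric] by (rule lim(1)) (rule freq)
    qed
  qed
qed

end
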